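(* Let $X$ be a separable Banach space and let $K\subset X$ be a closed convex cone with nonempty interior. Suppose that $f:X\to\mathbb{R}$ is $K$-monotone. Then $f$ is Gâteaux differentiable on $X$ except for a set belonging to $\tilde{\mathcal{C}}$.
   Context: All Banach spaces are real. For a cone $\emptyset\neq K\subset X$, $x\leq_K y$ means $y-x\in K$. $f:X\to\mathbb{R}$ is $K$-increasing if $x\leq_K y$ implies $f(x)\leq f(y)$ for all $x,y\in X$; $f$ is $K$-monotone if $f$ or $-f$ is $K$-increasing. For $x,v\in X$ put $f'(x,v)=\lim_{t\to 0}\frac{f(x+tv)-f(x)}{t}$ (two-sided limit). $f$ is Gâteaux differentiable at $x$ if $f'(x,v)$ exists for all $v\in X$ and $v\mapsto f'(x,v)$ is a bounded linear functional on $X$. Let $X$ be a separable Banach space, $0\neq v\in X$ and $\varepsilon>0$. $\tilde{\mathcal{A}}(v,\varepsilon)$ is the system of all Borel sets $B\subset X$ such that $\{t\in\mathbb{R}:\varphi(t)\in B\}$ is Lebesgue null whenever $\varphi:\mathbb{R}\to X$ is such that the function $t\mapsto\varphi(t)-tv$ has Lipschitz constant at most $\varepsilon$. $\tilde{\mathcal{A}}(v)$ is the system of all sets $B=\bigcup_{k=1}^\infty B_k$ where $B_k\in\tilde{\mathcal{A}}(v,\varepsilon_k)$ for some $\varepsilon_k>0$. $\tilde{\mathcal{C}}$ is the system of those $B\subset X$ that, for some sequence $(v_n)_n$ of nonzero vectors in $X$, can be written as $B=\bigcup_{n=1}^\infty B_n$ with $B_n\in\tilde{\mathcal{A}}(v_n)$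 for each $n$. *)

theory Defs
  imports "HOL-Analysis.Analysis"
begin

definition cone_le :: "'a::real_normed_vector set \<Rightarrow> 'a \<Rightarrow> 'a \<Rightarrow> bool" where
  "cone_le K x y \<longleftrightarrow> y - x \<in> K"

definition cone_increasing :: "'a::real_normed_vector set \<Rightarrow> ('a \<Rightarrow> real) \<Rightarrow> bool" where
  "cone_increasing K f \<longleftrightarrow> (\<forall>x y. cone_le K x y \<longrightarrow> f x \<le> f y)"

definition cone_monotone :: "'a::real_normed_vector set \<Rightarrow> ('a \<Rightarrow> real) \<Rightarrow> bool" where
  "cone_monotone K f \<longleftrightarrow> cone_increasing K f \<or> cone_increasing K (\<lambda>x. - f x)"

definition has_dir_deriv ::
    "('a::real_normed_vector \<Rightarrow> real) \<Rightarrow> 'a \<Rightarrow> 'a \<Rightarrow> real \<Rightarrow> bool" where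
  "has_dir_deriv f x v d \<longleftrightarrow> ((\<lambda>t. (f (x + t *\<^sub>R v) - f x) / t) \<longlongrightarrow> d) (at (0::real))"

text \<open>The value is meaningful only if the two-sided limit exists.\<close>

definition dir_deriv :: "('a::real_normed_vector \<Rightarrow> real) \<Rightarrow> 'a \<Rightarrow> 'a \<Rightarrow> real" where
  "dir_deriv f x v = (THE d. has_dir_deriv f x v d)"

definition gateaux_differentiable_at ::
    "('a::real_normed_vector \<Rightarrow> real) \<Rightarrow> 'a \<Rightarrow> bool" where
  "gateaux_differentiable_at f x \<longleftrightarrow>
     (\<forall>v. \<exists>d. has_dir_deriv f x v d) \<and> bounded_linear (\<lambda>v. dir_deriv f x v)"

text \<open>The set systems below are meant for nonzero directions \<open>v\<close>; this is
  enforced where the directions are chosen, in \<open>C_tilde\<close>.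
  On the zero space there is no such direction, so \<open>C_tilde\<close> is empty there and does not
  even contain \<open>{}\<close>.\<close>

definition A_tilde_eps :: "'a::real_normed_vector \<Rightarrow> real \<Rightarrow> 'a set set" where
  "A_tilde_eps v \<epsilon> =
     {B \<in> sets borel.
        \<forall>\<phi> :: real \<Rightarrow> 'a.
          \<epsilon>-lipschitz_on UNIV (\<lambda>t. \<phi> t - t *\<^sub>R v) \<longrightarrow> {t. \<phi> t \<in> B} \<in> null_sets lebesgue}"

definition A_tilde :: "'a::real_normed_vector \<Rightarrow> 'a set set" where
  "A_tilde v =
     {B. \<exists>(Bs :: nat \<Rightarrow> 'a set) (\<epsilon> :: nat \<Rightarrow> real).
           (\<forall>k. \<epsilon> k > 0 \<and> Bs k \<in> A_tilde_eps v (\<epsilon> k)) \<and> B = (\<Union>k. Bs k)}"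

definition C_tilde :: "'a::real_normed_vector set set" where
  "C_tilde =
     {B. \<exists>(v :: nat \<Rightarrow> 'a) (Bs :: nat \<Rightarrow> 'a set).
           (\<forall>n. v n \<noteq> 0 \<and> Bs n \<in> A_tilde (v n)) \<and> B = (\<Union>n. Bs n)}"

end

theory Submission
  imports Defs
begin

text \<open>Everything rests on two consequences of monotonicity, both read off along the curves
  \<open>\<phi>\<close> with \<open>\<phi> t - t v\<close> Lipschitz that test smallness in \<open>A_tilde_eps\<close>.

  If \<open>w\<close> is interior to \<open>K\<close> and \<open>\<phi>\<close> moves in direction \<open>w\<close> up to a small Lipschitz error, then
  \<open>f \<circ> \<phi>\<close> is a monotone function of a real variable, hence differentiable almost everywhere by
  Lebesgue's theorem. Since \<open>\<phi> (t + (1 - \<kappa>) s) \<le> \<phi> t + s w \<le> \<phi> (t + (1 + \<kappa>) s)\<close> in the order of \<open>K\<close>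
  (for \<open>s > 0\<close>), the difference quotients of \<open>f\<close> at \<open>\<phi> t\<close> in direction \<open>w\<close> are then squeezed between
  \<open>1 - \<kappa>\<close> and \<open>1 + \<kappa>\<close> times those of \<open>f \<circ> \<phi>\<close>. So the points at which the derivative in direction
  \<open>w\<close> fails to exist are covered by countably many members of \<open>A_tilde_eps w\<close>
  (\<open>exceptional_unbracketed\<close>).

  Now let \<open>w\<close> and \<open>v\<close> both be interior. Every direction has the form \<open>w - v\<close>, and the derivative in
  it ought to be \<open>f' w - f' v\<close>. Consider the points \<open>x\<close> at which the quotients in
  directions \<open>w\<close> and \<open>v\<close> are within \<open>\<delta>\<close> of fixed numbers \<open>p\<close> and \<open>q\<close> at all small scales. If \<open>y\<close> is
  another such point, close to \<open>x - s v\<close>, then \<open>x + s (w - v)\<close> is close to \<open>y + s w\<close>, and monotonicity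
  gives a quotient near \<open>p - q\<close> at \<open>x\<close> in direction \<open>w - v\<close>. Hence, whenever that quotient is wrong at
  scale \<open>s\<close>, a whole ball of radius proportional to \<open>s\<close> around \<open>x - s v\<close> contains no such point: the
  bad points form a set that is porous in direction \<open>v\<close>, and its preimages under the test curves are
  porous subsets of the line, hence null (\<open>nonadditive_in_A_tilde_eps\<close>).

  Both facts are applied to a countable set of interior directions, dense in the interior of \<open>K\<close>.
  Monotonicity sandwiches every other direction, so that outside countably many small sets all
  directional derivatives exist and form a bounded linear functional
  (\<open>gateaux_if_countably_tested\<close>).

  One difficulty remains: members of the set systems are Borel sets, while a monotone \<open>f\<close> need not be
  Borel. The regularisation \<open>lower_envelope v f\<close> is Borel and increasing, and it is Gateaux
  differentiable at exactly the same points as \<open>f\<close> (\<open>gateaux_lower_envelope_iff\<close>). For it, Gateaux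
  differentiability is a condition on countably many rational difference quotients, so the set of
  bad points is Borel.\<close>

section \<open>Small sets and monotone functions on the real line\<close>

text \<open>The Vitali covering theorem in the form used for derivatives. The intervals stay inside a given
  open set, so their total length is controlled by its measure, and they are covering even after
  their endpoints are dropped, so that the covering can be refined a second time inside them.\<close>

lemma Vitali_covering_intervals:
  fixes E U :: "real set" and K :: "(real \<times> real) set"
  assumes "open U" "E \<subseteq> U"
    and K: "\<And>t \<eta>. t \<in> E \<Longrightarrow> 0 < \<eta> \<Longrightarrow>
           \<exists>c d. (c, d) \<in> K \<and> c < d \<and> c \<le> t \<and> t \<le> d \<and> d - c < \<eta>"
  obtains C where "countable C" "C \<subseteq> K" "\<And>c d. (c, d) \<in> C \<Longrightarrow> c < d \<and> {c..d} \<subseteq> U"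
    "disjoint_family_on (\<lambda>(c, d). {c..d}) C"
    "negligible (E - (\<Union>(c, d)\<in>C. {c<..<d}))"
proof -
  define a r :: "real \<times> real \<Rightarrow> real" where "a = (\<lambda>(c, d). (c + d) / 2)" and "r = (\<lambda>(c, d). (d - c) / 2)"
  have cball: "cball (a (c, d)) (r (c, d)) = {c..d}" for c d
    by (auto simp: a_def r_def cball_eq_atLeastAtMost field_simps)
  define K' where "K' = {(c, d). (c, d) \<in> K \<and> c < d \<and> {c..d} \<subseteq> U}"
  have r: "0 < r i" if "i \<in> K'" for i
    using that by (auto simp: K'_def r_def)
  have fine: "\<exists>i. i \<in> K' \<and> t \<in> cball (a i) (r i) \<and> r i < \<eta>" if t: "t \<in> E" and "0 < \<eta>" for t \<eta>
  proof -
    obtain e where e: "e > 0" "ball t e \<subseteq> U"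
      using t assms(1,2) by (meson open_contains_ball subsetD)
    obtain c d where cd: "(c, d) \<in> K" "c < d" "c \<le> t" "t \<le> d" "d - c < min e \<eta>"
      using K[OF t, of "min e \<eta>"] e \<open>0 < \<eta>\<close> by auto
    have "{c..d} \<subseteq> ball t e"
      using cd by (auto simp: dist_real_def)
    then have "(c, d) \<in> K'" using cd e by (auto simp: K'_def)
    moreover have "t \<in> cball (a (c, d)) (r (c, d))" using cd by (simp only: cball) auto
    moreover have "r (c, d) < \<eta>" using cd by (auto simp: r_def)
    ultimately show ?thesis by blast
  qed
  obtain C where C: "countable C" "C \<subseteq> K'"
     "pairwise (\<lambda>i j. disjnt (cball (a i) (r i)) (cball (a j) (r j))) C"
     "negligible (E - (\<Union>i \<in> C. cball (a i) (r i)))"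
    by (rule Vitali_covering_theorem_cballs[of K' r E a, OF r fine]) blast+
  show thesis
  proof
    show "countable C" "C \<subseteq> K" using C by (auto simp: K'_def)
    show "c < d \<and> {c..d} \<subseteq> U" if "(c, d) \<in> C" for c d
      using that C(2) by (auto simp: K'_def)
    show "disjoint_family_on (\<lambda>(c, d). {c..d}) C"
      unfolding disjoint_family_on_def
    proof (intro ballI impI)
      fix i j assume ij: "i \<in> C" "j \<in> C" "i \<noteq> j"
      obtain c d c' d' where "i = (c, d)" "j = (c', d')" by (cases i, cases j)
      then show "(case i of (c, d) \<Rightarrow> {c..d}) \<inter> (case j of (c, d) \<Rightarrow> {c..d}) = {}"
        using pairwiseD[OF C(3) ij] by (simp add: cball disjnt_def)
    qed
    have "countable (fst ` C \<union> snd ` C)" using C(1) by auto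
    then have "fst ` C \<union> snd ` C \<in> null_sets lebesgue"
      by (intro null_sets_completionI countable_imp_null_set_lborel)
    then have "negligible (fst ` C \<union> snd ` C)" by (simp add: negligible_iff_null_sets)
    then have neg: "negligible ((E - (\<Union>i \<in> C. cball (a i) (r i))) \<union> (fst ` C \<union> snd ` C))"
      by (rule negligible_Un[OF C(4)])
    show "negligible (E - (\<Union>(c, d)\<in>C. {c<..<d}))"
    proof (rule negligible_subset[OF neg])
      show "E - (\<Union>(c, d)\<in>C. {c<..<d}) \<subseteq> (E - (\<Union>i \<in> C. cball (a i) (r i))) \<union> (fst ` C \<union> snd ` C)"
      proof
        fix t assume t: "t \<in> E - (\<Union>(c, d)\<in>C. {c<..<d})"
        show "t \<in> (E - (\<Union>i \<in> C. cball (a i) (r i))) \<union> (fst ` C \<union> snd ` C)"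
        proof (cases "\<exists>i\<in>C. t \<in> cball (a i) (r i)")
          case True
          then obtain i where i: "i \<in> C" "t \<in> cball (a i) (r i)" by blast
          obtain c d where "i = (c, d)" by (cases i)
          with i have cd: "(c, d) \<in> C" "t \<in> {c..d}" by (simp_all add: cball)
          moreover have "t \<notin> {c<..<d}" using t cd(1) by blast
          ultimately have "t = c \<or> t = d" by auto
          then show ?thesis using cd by force
        qed (use t in blast)
      qed
    qed
  qed
qed

text \<open>The outer measure \<open>m\<close> of \<open>E\<close> then satisfies \<open>m \<le> \<theta> m\<close>, and it is finite because of \<open>W\<close>. Arguing
  with covers instead of with \<open>E\<close> itself avoids all measurability questions about \<open>E\<close>.\<close>

lemma negligible_if_shrinking_covers:
  fixes E :: "'a::euclidean_space set" and \<theta> :: real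
  assumes "0 \<le> \<theta>" "\<theta> < 1" and W: "W \<in> lmeasurable" "E \<subseteq> W"
    and shrink: "\<And>U. open U \<Longrightarrow> U \<in> lmeasurable \<Longrightarrow> E \<subseteq> U \<Longrightarrow>
      \<exists>V\<in>lmeasurable. negligible (E - V) \<and> measure lebesgue V \<le> \<theta> * measure lebesgue U"
  shows "negligible E"
proof -
  define M where "M = {measure lebesgue U | U. U \<in> lmeasurable \<and> E \<subseteq> U}"
  have ne: "M \<noteq> {}" using W by (auto simp: M_def)
  have bdd: "bdd_below M" by (rule bdd_belowI[of _ 0]) (auto simp: M_def)
  have Inf0: "0 \<le> Inf M" by (rule cInf_greatest[OF ne]) (auto simp: M_def)
  have le: "Inf M \<le> \<theta> * (Inf M + e)" if "e > 0" for e
  proof -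
    have "\<exists>m\<in>M. m < Inf M + e / 2" using that by (intro cInf_lessD[OF ne]) simp
    then obtain U where U: "U \<in> lmeasurable" "E \<subseteq> U" "measure lebesgue U < Inf M + e / 2"
      unfolding M_def by blast
    have "U \<in> sets lebesgue" using U(1) by auto
    then obtain T where T: "open T" "U \<subseteq> T" "T - U \<in> lmeasurable" "emeasure lebesgue (T - U) < ennreal (e / 2)"
      using \<open>e > 0\<close> sets_lebesgue_outer_open[of U "e / 2"] by (metis half_gt_zero)
    have Tm: "T \<in> lmeasurable"
      using fmeasurable.Un[OF U(1) T(3)] T(2) by (simp add: Un_absorb1)
    have "measure lebesgue (T - U) < e / 2"
      using T(3,4) by (simp add: emeasure_eq_measure2 ennreal_less_iff)
    moreover have "measure lebesgue T = measure lebesgue U + measure lebesgue (T - U)"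
      using U(1) T(2) Tm by (simp add: measurable_measure_Diff fmeasurableD)
    ultimately have T4: "measure lebesgue T < Inf M + e" using U(3) by linarith
    obtain V where V: "V \<in> lmeasurable" "negligible (E - V)" "measure lebesgue V \<le> \<theta> * measure lebesgue T"
      using shrink[OF T(1) Tm] T(2) U(2) by blast
    have "V \<union> (E - V) \<in> lmeasurable" 
      by (rule fmeasurable.Un[OF V(1) negligible_imp_measurable[OF V(2)]])
    moreover have "measure lebesgue (V \<union> (E - V)) = measure lebesgue V"
    proof (rule measure_negligible_symdiff)
      show "V \<in> lmeasurable" by fact
      have "sym_diff V (V \<union> (E - V)) = E - V" by blast
      then show "negligible (sym_diff V (V \<union> (E - V)))" using V(2) by simp
    qed
    ultimately have "measure lebesgue V \<in> M"
      unfolding M_def mem_Collect_eq by (intro exI[of _ "V \<union> (E - V)"]) simp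
    then have "Inf M \<le> measure lebesgue V" using bdd by (rule cInf_lower)
    also note V(3)
    also have "\<theta> * measure lebesgue T \<le> \<theta> * (Inf M + e)"
      using T4 \<open>0 \<le> \<theta>\<close> by (intro mult_left_mono) auto
    finally show ?thesis .
  qed
  have "Inf M \<le> \<theta> * Inf M"
  proof (rule field_le_epsilon)
    fix e :: real assume "e > 0"
    have "Inf M \<le> \<theta> * (Inf M + e)" using le[OF \<open>e > 0\<close>] .
    also have "\<dots> \<le> \<theta> * Inf M + e" using assms(1,2) \<open>e > 0\<close> by (simp add: distrib_left mult_left_le_one_le)
    finally show "Inf M \<le> \<theta> * Inf M + e" .
  qed
  then have "Inf M = 0" using Inf0 \<open>\<theta> < 1\<close> mult_less_cancel_right2[of \<theta> "Inf M"] by force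
  show ?thesis unfolding negligible_outer_le
  proof (intro allI impI)
    fix e :: real assume "e > 0"
    then have "\<exists>m\<in>M. m < e" using \<open>Inf M = 0\<close> by (intro cInf_lessD[OF ne]) simp
    then obtain U where "U \<in> lmeasurable" "E \<subseteq> U" "measure lebesgue U < e"
      unfolding M_def by blast
    then show "\<exists>T. E \<subseteq> T \<and> T \<in> lmeasurable \<and> measure lebesgue T \<le> e" using less_imp_le by blast
  qed
qed

text \<open>Countable disjoint unions inherit termwise comparisons of length. This is all the summation that
  is needed: increments \<open>h d - h c\<close> of a monotone function are treated as lengths of the disjoint
  intervals \<open>{h c<..<h d}\<close>, so that no sums of increments have to be estimated.\<close>

lemma emeasure_disjoint_UN_le:
  fixes X Y :: "'i \<Rightarrow> real set" and a :: real
  assumes "countable C" "disjoint_family_on X C" "disjoint_family_on Y C"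
    and X: "\<And>i. i \<in> C \<Longrightarrow> X i \<in> sets borel" and Y: "\<And>i. i \<in> C \<Longrightarrow> Y i \<in> sets borel"
    and le: "\<And>i. i \<in> C \<Longrightarrow> emeasure lborel (X i) \<le> ennreal a * emeasure lborel (Y i)"
  shows "emeasure lborel (\<Union>i\<in>C. X i) \<le> ennreal a * emeasure lborel (\<Union>i\<in>C. Y i)"
proof -
  have "emeasure lborel (\<Union>i\<in>C. X i) = (\<integral>\<^sup>+i. emeasure lborel (X i) \<partial>count_space C)"
    by (rule emeasure_UN_countable) (use assms in auto)
  also have "\<dots> \<le> (\<integral>\<^sup>+i. ennreal a * emeasure lborel (Y i) \<partial>count_space C)"
    by (rule nn_integral_mono) (use le in auto)
  also have "\<dots> = ennreal a * (\<integral>\<^sup>+i. emeasure lborel (Y i) \<partial>count_space C)"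
    by (rule nn_integral_cmult) simp
  also have "(\<integral>\<^sup>+i. emeasure lborel (Y i) \<partial>count_space C) = emeasure lborel (\<Union>i\<in>C. Y i)"
    by (rule emeasure_UN_countable[symmetric]) (use assms in auto)
  finally show ?thesis .
qed

lemma measure_disjoint_UN_le:
  fixes X Y :: "'i \<Rightarrow> real set" and a :: real
  assumes "countable C" "disjoint_family_on X C" "disjoint_family_on Y C"
    and X: "\<And>i. i \<in> C \<Longrightarrow> X i \<in> sets borel" and Y: "\<And>i. i \<in> C \<Longrightarrow> Y i \<in> sets borel"
    and le: "\<And>i. i \<in> C \<Longrightarrow> emeasure lborel (X i) \<le> ennreal a * emeasure lborel (Y i)"
    and "0 \<le> a" and U: "U \<in> lmeasurable" "\<And>i. i \<in> C \<Longrightarrow> Y i \<subseteq> U"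
  shows "(\<Union>i\<in>C. X i) \<in> lmeasurable \<and> measure lebesgue (\<Union>i\<in>C. X i) \<le> a * measure lebesgue U"
proof -
  have Xb: "(\<Union>i\<in>C. X i) \<in> sets borel" and Yb: "(\<Union>i\<in>C. Y i) \<in> sets borel"
    using assms by (auto intro!: sets.countable_UN'')
  have "emeasure lebesgue (\<Union>i\<in>C. X i) \<le> ennreal a * emeasure lebesgue (\<Union>i\<in>C. Y i)"
    using emeasure_disjoint_UN_le[OF assms(1-6)] Xb Yb by simp
  also have "\<dots> \<le> ennreal a * emeasure lebesgue U"
    using U by (intro mult_left_mono emeasure_mono) auto
  also have "\<dots> = ennreal (a * measure lebesgue U)"
    using U \<open>0 \<le> a\<close> by (simp add: emeasure_eq_measure2 ennreal_mult)
  finally have le: "emeasure lebesgue (\<Union>i\<in>C. X i) \<le> ennreal (a * measure lebesgue U)" .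
  then have "(\<Union>i\<in>C. X i) \<in> lmeasurable"
    using Xb by (intro fmeasurableI) (auto simp: le_less_trans[OF _ ennreal_less_top])
  with le \<open>0 \<le> a\<close> show ?thesis by (simp add: emeasure_eq_measure2)
qed

lemma negligible_if_bounded_pieces:
  fixes E :: "real set"
  assumes "\<And>M. negligible (E \<inter> {-M<..<M})"
  shows "negligible E"
proof -
  have "negligible (\<Union>n::nat. E \<inter> {- real n<..<real n})"
    by (intro negligible_countable_Union) (auto intro: assms)
  moreover have "E \<subseteq> (\<Union>n::nat. E \<inter> {- real n<..<real n})"
  proof
    fix t assume "t \<in> E"
    moreover obtain n where "\<bar>t\<bar> < real n" using reals_Archimedean2 by blast
    ultimately show "t \<in> (\<Union>n::nat. E \<inter> {- real n<..<real n})"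
      by (intro UN_I[of n]) auto
  qed
  ultimately show ?thesis by (rule negligible_subset)
qed

text \<open>A Vitali covering by intervals that carry a hole of proportion \<open>\<rho> / 2\<close> on each side of a centre
  loses the fixed proportion \<open>\<rho>\<close> of its measure when the holes are removed.\<close>

theorem negligible_if_uniformly_porous:
  fixes E :: "real set"
  assumes "0 < \<rho>" "\<rho> < 1"
    and porous: "\<And>t \<eta>. t \<in> E \<Longrightarrow> 0 < \<eta> \<Longrightarrow>
      \<exists>s. 0 < \<bar>s\<bar> \<and> \<bar>s\<bar> < \<eta> \<and> {t + s - \<rho> * \<bar>s\<bar>..t + s + \<rho> * \<bar>s\<bar>} \<inter> E = {}"
  shows "negligible E"
proof (rule negligible_if_bounded_pieces)
  fix M :: real
  show "negligible (E \<inter> {-M<..<M})"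
  proof (rule negligible_if_shrinking_covers[where \<theta> = "1 - \<rho>" and W = "{-M<..<M}"])
    let ?E = "E \<inter> {-M<..<M}"
    fix U :: "real set" assume U: "open U" "U \<in> lmeasurable" "?E \<subseteq> U"
    \<comment> \<open>A pair in \<open>K\<close> has length \<open>2 \<bar>s\<bar>\<close>, so its hole of radius \<open>\<rho> \<bar>s\<bar>\<close> takes up the proportion \<open>\<rho>\<close>.\<close>
    define hole where "hole = (\<lambda>c d p. {p - \<rho> * (d - c) / 2..p + \<rho> * (d - c) / 2})"
    define K where "K = {(c, d). \<exists>p. c < d \<and> hole c d p \<subseteq> {c..d} \<and> hole c d p \<inter> E = {}}"
    have fine: "\<exists>c d. (c, d) \<in> K \<and> c < d \<and> c \<le> t \<and> t \<le> d \<and> d - c < \<eta>"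
      if t: "t \<in> ?E" and "0 < \<eta>" for t \<eta>
    proof -
      obtain s where s: "0 < \<bar>s\<bar>" "\<bar>s\<bar> < \<eta> / 2" "{t + s - \<rho> * \<bar>s\<bar>..t + s + \<rho> * \<bar>s\<bar>} \<inter> E = {}"
        using porous[of t "\<eta> / 2"] t \<open>0 < \<eta>\<close> by auto
      define c d where "c = (if s > 0 then t else t - 2 * \<bar>s\<bar>)" and "d = (if s > 0 then t + 2 * \<bar>s\<bar> else t)"
      have dc: "d - c = 2 * \<bar>s\<bar>" by (simp add: c_def d_def)
      have "\<rho> * \<bar>s\<bar> \<le> \<bar>s\<bar>" using assms by (simp add: mult_left_le_one_le)
      then have "hole c d (t + s) \<subseteq> {c..d}"
        unfolding hole_def dc using s(1) by (auto simp: c_def d_def)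
      moreover have "hole c d (t + s) \<inter> E = {}" using s(3) by (simp add: hole_def dc)
      moreover have "c < d" using s(1) dc by linarith
      ultimately have "(c, d) \<in> K" unfolding K_def by blast
      with s show ?thesis by (intro exI[of _ c] exI[of _ d]) (auto simp: c_def d_def)
    qed
    obtain C where C: "countable C" "C \<subseteq> K" "\<And>c d. (c, d) \<in> C \<Longrightarrow> c < d \<and> {c..d} \<subseteq> U"
      "disjoint_family_on (\<lambda>(c, d). {c..d}) C" "negligible (?E - (\<Union>(c, d)\<in>C. {c<..<d}))"
      by (rule Vitali_covering_intervals[OF U(1,3) fine]) blast+
    have "\<forall>i\<in>C. \<exists>p. hole (fst i) (snd i) p \<subseteq> {fst i..snd i} \<and> hole (fst i) (snd i) p \<inter> E = {}"
    proof
      fix i assume "i \<in> C"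
      obtain c d where i: "i = (c, d)" by (cases i)
      have "(c, d) \<in> K" using C(2) \<open>i \<in> C\<close> i by blast
      then show "\<exists>p. hole (fst i) (snd i) p \<subseteq> {fst i..snd i} \<and> hole (fst i) (snd i) p \<inter> E = {}"
        unfolding K_def i by simp
    qed
    then have "\<exists>p. \<forall>i\<in>C. hole (fst i) (snd i) (p i) \<subseteq> {fst i..snd i} \<and> hole (fst i) (snd i) (p i) \<inter> E = {}"
      by (rule bchoice)
    then obtain p where p: "\<And>i. i \<in> C \<Longrightarrow> hole (fst i) (snd i) (p i) \<subseteq> {fst i..snd i} \<and> hole (fst i) (snd i) (p i) \<inter> E = {}"
      by blast
    define X Y :: "real \<times> real \<Rightarrow> real set"
      where "X = (\<lambda>i. {fst i..snd i} - hole (fst i) (snd i) (p i))" and "Y = (\<lambda>i. {fst i..snd i})"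
    have dY: "disjoint_family_on Y C" using C(4) by (simp add: Y_def case_prod_beta')
    have dX: "disjoint_family_on X C"
      using dY unfolding disjoint_family_on_def X_def Y_def by blast
    have le: "emeasure lborel (X i) \<le> ennreal (1 - \<rho>) * emeasure lborel (Y i)" if "i \<in> C" for i
    proof -
      have less: "fst i < snd i" using C(3)[of "fst i" "snd i"] that by simp
      have hole: "emeasure lborel (hole (fst i) (snd i) (p i)) = ennreal (\<rho> * (snd i - fst i))"
        unfolding hole_def using less \<open>0 < \<rho>\<close> by (subst emeasure_lborel_Icc) (auto intro!: add_increasing2)
      have "emeasure lborel (X i) = emeasure lborel {fst i..snd i} - emeasure lborel (hole (fst i) (snd i) (p i))"
        unfolding X_def
      proof (rule emeasure_Diff)
        show "emeasure lborel (hole (fst i) (snd i) (p i)) \<noteq> \<infinity>" using hole by simp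
        show "hole (fst i) (snd i) (p i) \<subseteq> {fst i..snd i}" using p[OF that] by blast
      qed (auto simp: hole_def)
      also have "\<dots> = ennreal (snd i - fst i) - ennreal (\<rho> * (snd i - fst i))"
        using less by (simp add: hole)
      also have "\<dots> = ennreal ((1 - \<rho>) * (snd i - fst i))"
        using less \<open>0 < \<rho>\<close> \<open>\<rho> < 1\<close> by (subst ennreal_minus) (auto simp: algebra_simps)
      also have "\<dots> = ennreal (1 - \<rho>) * emeasure lborel (Y i)"
        using less \<open>0 < \<rho>\<close> \<open>\<rho> < 1\<close> by (simp add: Y_def ennreal_mult)
      finally show ?thesis by simp
    qed
    have XV: "(\<Union>i\<in>C. X i) \<in> lmeasurable \<and> measure lebesgue (\<Union>i\<in>C. X i) \<le> (1 - \<rho>) * measure lebesgue U"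
    proof (rule measure_disjoint_UN_le[OF C(1) dX dY _ _ le])
      show "0 \<le> 1 - \<rho>" using \<open>\<rho> < 1\<close> by simp
      show "U \<in> lmeasurable" by fact
      show "Y i \<subseteq> U" if "i \<in> C" for i
        using C(3)[of "fst i" "snd i"] that by (simp add: Y_def)
    qed (auto simp: X_def Y_def hole_def)
    moreover have "negligible (?E - (\<Union>i\<in>C. X i))"
    proof (rule negligible_subset[OF C(5)])
      have "\<exists>i\<in>C. t \<in> X i" if "t \<in> E" "(c, d) \<in> C" "c < t" "t < d" for t c d
        using that p[of "(c, d)"] by (intro bexI[of _ "(c, d)"]) (auto simp: X_def)
      then show "?E - (\<Union>i\<in>C. X i) \<subseteq> ?E - (\<Union>(c, d)\<in>C. {c<..<d})" by fastforce
    qed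
    ultimately show "\<exists>V\<in>lmeasurable. negligible (?E - V) \<and> measure lebesgue V \<le> (1 - \<rho>) * measure lebesgue U"
      by blast
  qed (use \<open>0 < \<rho>\<close> \<open>\<rho> < 1\<close> in simp_all)
qed

text \<open>The limit inferior and limit superior agree when no rational interval lies between them.\<close>

lemma limit_if_no_crossings:
  fixes g :: "'i \<Rightarrow> real"
  assumes "F \<noteq> bot" and lower: "eventually (\<lambda>s. A \<le> g s) F" and upper: "eventually (\<lambda>s. g s \<le> B) F"
    and no_cross: "\<And>a b. a \<in> \<rat> \<Longrightarrow> b \<in> \<rat> \<Longrightarrow> a < b \<Longrightarrow>
      \<not> ((\<exists>\<^sub>F s in F. g s < a) \<and> (\<exists>\<^sub>F s in F. b < g s))"
  shows "\<exists>l. (g \<longlongrightarrow> l) F"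
proof -
  define S where "S = {a. eventually (\<lambda>s. a \<le> g s) F}"
  have S_le: "a \<le> B" if "a \<in> S" for a
  proof -
    have "eventually (\<lambda>s. a \<le> B) F"
      using that upper unfolding S_def by (auto elim: eventually_elim2)
    then show ?thesis using \<open>F \<noteq> bot\<close> by (simp add: eventually_const)
  qed
  have S: "S \<noteq> {}" "bdd_above S" using lower S_le by (auto simp: S_def bdd_above_def)
  have "(g \<longlongrightarrow> Sup S) F"
  proof (rule order_tendstoI)
    fix y assume "y < Sup S"
    then obtain a where "a \<in> S" "y < a" using less_cSup_iff[OF S] by blast
    then show "eventually (\<lambda>s. y < g s) F"
      unfolding S_def by (auto elim: eventually_mono)
  next
    fix y assume "Sup S < y"
    then obtain b where b: "b \<in> \<rat>" "Sup S < b" "b < y" using Rats_dense_in_real by blast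
    obtain a where a: "a \<in> \<rat>" "Sup S < a" "a < b" using Rats_dense_in_real[OF b(2)] by blast
    have "a \<notin> S" using a(2) cSup_upper[OF _ S(2)] by force
    then have "\<exists>\<^sub>F s in F. g s < a" by (simp add: S_def frequently_def not_less)
    then have "\<not> (\<exists>\<^sub>F s in F. b < g s)" using no_cross[OF a(1) b(1) a(3)] by blast
    then show "eventually (\<lambda>s. g s < y) F"
      using b(3) by (auto simp: frequently_def not_less elim: eventually_mono)
  qed
  then show ?thesis by blast
qed

lemma disjoint_monotone_images:
  fixes h :: "real \<Rightarrow> real"
  assumes "mono h" "disjoint_family_on (\<lambda>(c, d). {c..d}) C" and C: "\<And>c d. (c, d) \<in> C \<Longrightarrow> c < d"
  shows "disjoint_family_on (\<lambda>(c, d). {h c<..<h d}) C"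
  unfolding disjoint_family_on_def
proof (intro ballI impI)
  fix i j assume ij: "i \<in> C" "j \<in> C" "i \<noteq> j"
  obtain c d c' d' where eq: "i = (c, d)" "j = (c', d')" by (cases i, cases j)
  have less: "c < d" "c' < d'" using C ij eq by auto
  have "{c..d} \<inter> {c'..d'} = {}"
    using disjoint_family_onD[OF assms(2) ij] eq by simp
  then have "d < c' \<or> d' < c" using less by (auto simp: Int_atLeastAtMost not_le)
  then have "h d \<le> h c' \<or> h d' \<le> h c" using monoD[OF \<open>mono h\<close>] less_imp_le by blast
  then show "(case i of (c, d) \<Rightarrow> {h c<..<h d}) \<inter> (case j of (c, d) \<Rightarrow> {h c<..<h d}) = {}"
    using eq by auto
qed

definition diff_quot :: "('a::real_normed_vector \<Rightarrow> real) \<Rightarrow> 'a \<Rightarrow> 'a \<Rightarrow> real \<Rightarrow> real" where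
  "diff_quot f x u s = (f (x + s *\<^sub>R u) - f x) / s"

text \<open>Increments over intervals with endpoint \<open>t\<close>, on either side, treat positive and negative \<open>s\<close> alike.\<close>

lemma diff_quot_interval:
  assumes "s \<noteq> 0"
  obtains c d where "c < d" "c \<le> t" "t \<le> d" "d - c = \<bar>s\<bar>" "h d - h c = diff_quot h t 1 s * (d - c)"
proof (cases "s > 0")
  case True then show thesis by (intro that[of t "t + s"]) (auto simp: diff_quot_def)
next
  case False then show thesis using assms by (intro that[of "t + s" t]) (auto simp: diff_quot_def field_simps)
qed

lemma small_frequently_at_0:
  assumes "\<exists>\<^sub>F s in at (0::real). P s" "0 < \<eta>"
  shows "\<exists>s. s \<noteq> 0 \<and> \<bar>s\<bar> < \<eta> \<and> P s"
  using assms unfolding frequently_at by (auto simp: dist_real_def)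

lemma measure_steep_intervals:
  fixes h :: "real \<Rightarrow> real"
  assumes "mono h" "0 < b" "countable C" "disjoint_family_on (\<lambda>(c, d). {c..d}) C"
    and C: "\<And>c d. (c, d) \<in> C \<Longrightarrow> c < d \<and> b * (d - c) \<le> h d - h c \<and> {h c<..<h d} \<subseteq> H"
    and H: "H \<in> lmeasurable"
  shows "(\<Union>(c, d)\<in>C. {c..d}) \<in> lmeasurable"
    and "measure lebesgue (\<Union>(c, d)\<in>C. {c..d}) \<le> (1 / b) * measure lebesgue H"
proof -
  have "(\<Union>(c, d)\<in>C. {c..d}) \<in> lmeasurable \<and> measure lebesgue (\<Union>(c, d)\<in>C. {c..d}) \<le> (1 / b) * measure lebesgue H"
  proof (rule measure_disjoint_UN_le[where Y = "\<lambda>(c, d). {h c<..<h d}"])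
    show "disjoint_family_on (\<lambda>(c, d). {h c<..<h d}) C"
      by (rule disjoint_monotone_images) (use assms(1,4) C in auto)
    fix i assume "i \<in> C"
    moreover obtain c d where i: "i = (c, d)" by (cases i)
    ultimately have cd: "c < d" "b * (d - c) \<le> h d - h c" "{h c<..<h d} \<subseteq> H" using C by auto
    then have "h c \<le> h d" using \<open>mono h\<close> by (simp add: monoD)
    moreover have "d - c \<le> (1 / b) * (h d - h c)" using cd(2) \<open>0 < b\<close> by (simp add: field_simps)
    ultimately have "ennreal (d - c) \<le> ennreal (1 / b) * ennreal (h d - h c)"
      using \<open>0 < b\<close> cd(1) by (simp add: ennreal_mult[symmetric] ennreal_leI)
    then show "emeasure lborel (case i of (c, d) \<Rightarrow> {c..d})
        \<le> ennreal (1 / b) * emeasure lborel (case i of (c, d) \<Rightarrow> {h c<..<h d})"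
      using cd(1) \<open>h c \<le> h d\<close> by (simp add: i)
    show "(case i of (c, d) \<Rightarrow> {h c<..<h d}) \<subseteq> H" using cd(3) i by simp
  qed (use assms in auto)
  then show "(\<Union>(c, d)\<in>C. {c..d}) \<in> lmeasurable"
    and "measure lebesgue (\<Union>(c, d)\<in>C. {c..d}) \<le> (1 / b) * measure lebesgue H" by blast+
qed

lemma measure_flat_intervals:
  fixes h :: "real \<Rightarrow> real"
  assumes "mono h" "0 < a" "countable C" "disjoint_family_on (\<lambda>(c, d). {c..d}) C"
    and C: "\<And>c d. (c, d) \<in> C \<Longrightarrow> c < d \<and> h d - h c \<le> a * (d - c) \<and> {c..d} \<subseteq> U"
    and U: "U \<in> lmeasurable"
  shows "(\<Union>(c, d)\<in>C. {h c<..<h d}) \<in> lmeasurable"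
    and "measure lebesgue (\<Union>(c, d)\<in>C. {h c<..<h d}) \<le> a * measure lebesgue U"
proof -
  have "(\<Union>(c, d)\<in>C. {h c<..<h d}) \<in> lmeasurable \<and> measure lebesgue (\<Union>(c, d)\<in>C. {h c<..<h d}) \<le> a * measure lebesgue U"
  proof (rule measure_disjoint_UN_le[where Y = "\<lambda>(c, d). {c..d}"])
    show "disjoint_family_on (\<lambda>(c, d). {h c<..<h d}) C"
      by (rule disjoint_monotone_images) (use assms(1,4) C in auto)
    fix i assume "i \<in> C"
    moreover obtain c d where i: "i = (c, d)" by (cases i)
    ultimately have cd: "c < d" "h d - h c \<le> a * (d - c)" "{c..d} \<subseteq> U" using C by auto
    then have "h c \<le> h d" using \<open>mono h\<close> by (simp add: monoD)
    then have "ennreal (h d - h c) \<le> ennreal a * ennreal (d - c)"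
      using \<open>0 < a\<close> cd(1,2) by (simp add: ennreal_mult[symmetric] ennreal_leI)
    then show "emeasure lborel (case i of (c, d) \<Rightarrow> {h c<..<h d})
        \<le> ennreal a * emeasure lborel (case i of (c, d) \<Rightarrow> {c..d})"
      using cd(1) \<open>h c \<le> h d\<close> by (simp add: i)
    show "(case i of (c, d) \<Rightarrow> {c..d}) \<subseteq> U" using cd(3) i by simp
  qed (use assms in auto)
  then show "(\<Union>(c, d)\<in>C. {h c<..<h d}) \<in> lmeasurable"
    and "measure lebesgue (\<Union>(c, d)\<in>C. {h c<..<h d}) \<le> a * measure lebesgue U" by blast+
qed

text \<open>On a bounded interval the total increment of \<open>h\<close> is finite, so intervals of slope at least \<open>b\<close>
  have total length at most a constant divided by \<open>b\<close>.\<close>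

lemma negligible_infinite_derivative:
  fixes h :: "real \<Rightarrow> real"
  assumes "mono h"
  shows "negligible {t. \<forall>b. \<exists>\<^sub>F s in at 0. b < diff_quot h t 1 s}" (is "negligible ?E")
proof (rule negligible_if_bounded_pieces)
  fix M :: real
  let ?I = "{-M<..<M}"
  show "negligible (?E \<inter> ?I)"
  proof (rule negligible_if_shrinking_covers[where \<theta> = "1/2" and W = ?I])
    fix U :: "real set" assume U: "open U" "U \<in> lmeasurable" "?E \<inter> ?I \<subseteq> U"
    show "\<exists>V\<in>lmeasurable. negligible (?E \<inter> ?I - V) \<and> measure lebesgue V \<le> 1/2 * measure lebesgue U"
    proof (cases "measure lebesgue U = 0")
      case True
      then show ?thesis using U by (intro bexI[of _ U]) (auto simp: Diff_eq_empty_iff[THEN iffD2])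
    next
      case False
      then have mU: "measure lebesgue U > 0" by (simp add: zero_less_measure_iff)
      let ?H = "{h (-M)..h M}"
      \<comment> \<open>The slope that makes the total length at most half of the measure of \<open>U\<close>.\<close>
      define b where "b = 2 * (measure lebesgue ?H + 1) / measure lebesgue U"
      have "b > 0" using mU by (simp add: b_def add_nonneg_pos)
      define K where "K = {(c, d). b * (d - c) \<le> h d - h c \<and> {c..d} \<subseteq> ?I}"
      have fine: "\<exists>c d. (c, d) \<in> K \<and> c < d \<and> c \<le> t \<and> t \<le> d \<and> d - c < \<eta>"
        if t: "t \<in> ?E \<inter> ?I" and "0 < \<eta>" for t \<eta>
      proof -
        define \<eta>' where "\<eta>' = min \<eta> (min (M - t) (M + t))"
        have "\<eta>' > 0" using t \<open>0 < \<eta>\<close> by (auto simp: \<eta>'_def)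
        moreover have "\<exists>\<^sub>F s in at 0. b < diff_quot h t 1 s" using t by blast
        ultimately obtain s where s: "s \<noteq> 0" "\<bar>s\<bar> < \<eta>'" "b < diff_quot h t 1 s"
          using small_frequently_at_0 by blast
        obtain c d where cd: "c < d" "c \<le> t" "t \<le> d" "d - c = \<bar>s\<bar>" "h d - h c = diff_quot h t 1 s * (d - c)"
          using diff_quot_interval[OF s(1)] by blast
        have "{c..d} \<subseteq> ?I" using cd(2,3,4) s(2) by (auto simp: \<eta>'_def)
        moreover have "b * (d - c) \<le> h d - h c" using cd(1,5) s(3) by simp
        ultimately show ?thesis using cd s(2) by (intro exI[of _ c] exI[of _ d]) (auto simp: K_def \<eta>'_def)
      qed
      obtain C where C: "countable C" "C \<subseteq> K" "\<And>c d. (c, d) \<in> C \<Longrightarrow> c < d \<and> {c..d} \<subseteq> ?I"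
        "disjoint_family_on (\<lambda>(c, d). {c..d}) C" "negligible (?E \<inter> ?I - (\<Union>(c, d)\<in>C. {c<..<d}))"
        by (rule Vitali_covering_intervals[OF open_greaterThanLessThan Int_lower2 fine]) blast+
      have steep: "c < d \<and> b * (d - c) \<le> h d - h c \<and> {h c<..<h d} \<subseteq> ?H" if "(c, d) \<in> C" for c d
      proof -
        have "c < d" "{c..d} \<subseteq> ?I" using C(3)[OF that] by auto
        moreover from \<open>c < d\<close> have "c \<in> {c..d}" "d \<in> {c..d}" by simp_all
        ultimately have "c \<in> ?I" "d \<in> ?I" by blast+
        then have "h (-M) \<le> h c" "h d \<le> h M" by (auto intro!: monoD[OF \<open>mono h\<close>])
        then have "{h c<..<h d} \<subseteq> ?H" by auto
        moreover have "b * (d - c) \<le> h d - h c" using C(2) that by (auto simp: K_def)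
        ultimately show ?thesis using \<open>c < d\<close> by blast
      qed
      let ?V = "\<Union>(c, d)\<in>C. {c..d}"
      note V = measure_steep_intervals[OF \<open>mono h\<close> \<open>b > 0\<close> C(1,4) steep, simplified]
      have "measure lebesgue ?V \<le> measure lebesgue ?H / b" using V(2) by simp
      also have "\<dots> \<le> 1/2 * measure lebesgue U"
        using \<open>b > 0\<close> mU by (simp add: b_def field_simps)
      finally have "measure lebesgue ?V \<le> 1/2 * measure lebesgue U" .
      moreover have "negligible (?E \<inter> ?I - ?V)"
        by (rule negligible_subset[OF C(5)]) auto
      ultimately show ?thesis using V(1) by blast
    qed
  qed auto
qed

text \<open>Cover \<open>E\<close> inside \<open>U\<close> by disjoint flat intervals, of slope at most \<open>a\<close>; the image of their union has
  measure at most \<open>a\<close> times that of \<open>U\<close>. Inside them cover \<open>E\<close> again by steep intervals, of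
  slope at least \<open>b\<close>; their images lie in the former image, so their total length is at
  most \<open>a / b\<close> times the measure of \<open>U\<close>.\<close>

lemma negligible_oscillating_derivative:
  fixes h :: "real \<Rightarrow> real"
  assumes "mono h" "0 < a" "a < b"
  shows "negligible {t. (\<exists>\<^sub>F s in at 0. diff_quot h t 1 s < a) \<and> (\<exists>\<^sub>F s in at 0. b < diff_quot h t 1 s)}" (is "negligible ?E")
proof (rule negligible_if_bounded_pieces)
  fix M :: real
  let ?I = "{-M<..<M}"
  show "negligible (?E \<inter> ?I)"
  proof (rule negligible_if_shrinking_covers[where \<theta> = "a / b" and W = ?I])
    fix U :: "real set" assume U: "open U" "U \<in> lmeasurable" "?E \<inter> ?I \<subseteq> U"
    define K where "K = {(c, d). h d - h c \<le> a * (d - c)}"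
    have fine: "\<exists>c d. (c, d) \<in> K \<and> c < d \<and> c \<le> t \<and> t \<le> d \<and> d - c < \<eta>"
      if t: "t \<in> ?E \<inter> ?I" and "0 < \<eta>" for t \<eta>
    proof -
      obtain s where s: "s \<noteq> 0" "\<bar>s\<bar> < \<eta>" "diff_quot h t 1 s < a"
        using small_frequently_at_0[OF _ \<open>0 < \<eta>\<close>, of "\<lambda>s. diff_quot h t 1 s < a"] t by blast
      obtain c d where cd: "c < d" "c \<le> t" "t \<le> d" "d - c = \<bar>s\<bar>" "h d - h c = diff_quot h t 1 s * (d - c)"
        using diff_quot_interval[OF s(1)] by blast
      then show ?thesis using s by (intro exI[of _ c] exI[of _ d]) (auto simp: K_def)
    qed
    obtain C where C: "countable C" "C \<subseteq> K" "\<And>c d. (c, d) \<in> C \<Longrightarrow> c < d \<and> {c..d} \<subseteq> U"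
      "disjoint_family_on (\<lambda>(c, d). {c..d}) C" "negligible (?E \<inter> ?I - (\<Union>(c, d)\<in>C. {c<..<d}))"
      by (rule Vitali_covering_intervals[OF U(1,3) fine]) blast+
    have flat: "c < d \<and> h d - h c \<le> a * (d - c) \<and> {c..d} \<subseteq> U" if "(c, d) \<in> C" for c d
      using C(2) C(3)[OF that] that by (auto simp: K_def)
    let ?H = "\<Union>(c, d)\<in>C. {h c<..<h d}"
    note H = measure_flat_intervals[OF \<open>mono h\<close> \<open>0 < a\<close> C(1,4) flat U(2), simplified]
    let ?W = "\<Union>(c, d)\<in>C. {c<..<d}"
    \<comment> \<open>Steep intervals must lie in a single flat interval, so that their images do as well.\<close>
    define K' where "K' = {(c, d). b * (d - c) \<le> h d - h c \<and> (\<exists>(c', d')\<in>C. {c..d} \<subseteq> {c'<..<d'})}"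
    have fine': "\<exists>c d. (c, d) \<in> K' \<and> c < d \<and> c \<le> t \<and> t \<le> d \<and> d - c < \<eta>"
      if t: "t \<in> ?E \<inter> ?I \<inter> ?W" and "0 < \<eta>" for t \<eta>
    proof -
      obtain c' d' where cd': "(c', d') \<in> C" "c' < t" "t < d'" using t by auto
      define \<eta>' where "\<eta>' = min \<eta> (min (d' - t) (t - c'))"
      have "\<eta>' > 0" using cd' \<open>0 < \<eta>\<close> by (auto simp: \<eta>'_def)
      then obtain s where s: "s \<noteq> 0" "\<bar>s\<bar> < \<eta>'" "b < diff_quot h t 1 s"
        using small_frequently_at_0[OF _ \<open>0 < \<eta>'\<close>, of "\<lambda>s. b < diff_quot h t 1 s"] t by blast
      obtain c d where cd: "c < d" "c \<le> t" "t \<le> d" "d - c = \<bar>s\<bar>" "h d - h c = diff_quot h t 1 s * (d - c)"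
        using diff_quot_interval[OF s(1)] by blast
      have "{c..d} \<subseteq> {c'<..<d'}" using cd(2,3,4) s(2) by (auto simp: \<eta>'_def)
      moreover have "b * (d - c) \<le> h d - h c" using cd(1,5) s(3) by simp
      ultimately have "(c, d) \<in> K'" unfolding K'_def using cd'(1) by blast
      then show ?thesis using cd s(2) by (intro exI[of _ c] exI[of _ d]) (auto simp: \<eta>'_def)
    qed
    have "open ?W" by (auto intro!: open_UN)
    obtain C' where C': "countable C'" "C' \<subseteq> K'" "\<And>c d. (c, d) \<in> C' \<Longrightarrow> c < d \<and> {c..d} \<subseteq> ?W"
      "disjoint_family_on (\<lambda>(c, d). {c..d}) C'" "negligible (?E \<inter> ?I \<inter> ?W - (\<Union>(c, d)\<in>C'. {c<..<d}))"
      by (rule Vitali_covering_intervals[OF \<open>open ?W\<close> Int_lower2 fine']) blast+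
    have steep: "c < d \<and> b * (d - c) \<le> h d - h c \<and> {h c<..<h d} \<subseteq> ?H" if cd: "(c, d) \<in> C'" for c d
    proof -
      have "c < d" using C'(3)[OF cd] by blast
      have "(c, d) \<in> K'" using C'(2) cd by blast
      then obtain c' d' where *: "(c', d') \<in> C" "{c..d} \<subseteq> {c'<..<d'}" "b * (d - c) \<le> h d - h c"
        unfolding K'_def by blast
      moreover have "c \<in> {c..d}" "d \<in> {c..d}" using \<open>c < d\<close> by simp_all
      ultimately have "c \<in> {c'<..<d'}" "d \<in> {c'<..<d'}" by blast+
      then have "h c' \<le> h c" "h d \<le> h d'" using \<open>mono h\<close> by (auto intro!: monoD[OF \<open>mono h\<close>])
      then have "{h c<..<h d} \<subseteq> {h c'<..<h d'}" by auto
      then show ?thesis using * \<open>c < d\<close> by blast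
    qed
    have "0 < b" using assms by linarith
    note V = measure_steep_intervals[OF \<open>mono h\<close> \<open>0 < b\<close> C'(1,4) steep H(1), simplified]
    let ?V = "\<Union>(c, d)\<in>C'. {c..d}"
    have "measure lebesgue ?V \<le> measure lebesgue ?H / b" using V(2) by simp
    also have "\<dots> \<le> a * measure lebesgue U / b"
      using H(2) \<open>0 < b\<close> by (intro divide_right_mono) auto
    finally have "measure lebesgue ?V \<le> a / b * measure lebesgue U" by simp
    moreover have "negligible (?E \<inter> ?I - ?V)"
      by (rule negligible_subset[OF negligible_Un[OF C(5) C'(5)]]) auto
    ultimately show "\<exists>V\<in>lmeasurable. negligible (?E \<inter> ?I - V) \<and> measure lebesgue V \<le> a / b * measure lebesgue U"
      using V(1) by blast
  qed (use assms in auto)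
qed

text \<open>Lebesgue's theorem on the differentiability of monotone functions. A derivative can fail to exist
  only because the quotients are unbounded or because they cross some interval with positive rational
  endpoints infinitely often.\<close>

theorem Lebesgue_monotone_differentiable:
  fixes h :: "real \<Rightarrow> real"
  assumes "mono h"
  shows "negligible {t. \<not> (\<exists>d. (diff_quot h t 1 \<longlongrightarrow> d) (at 0))}" (is "negligible ?N")
proof -
  let ?E = "{t. \<forall>b. \<exists>\<^sub>F s in at 0. b < diff_quot h t 1 s}"
  let ?O = "\<lambda>(a, b). {t. (\<exists>\<^sub>F s in at 0. diff_quot h t 1 s < a) \<and> (\<exists>\<^sub>F s in at 0. b < diff_quot h t 1 s)}"
  let ?R = "{(a::real, b::real). a \<in> \<rat> \<and> b \<in> \<rat> \<and> 0 < a \<and> a < b}"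
  have "countable (\<rat> \<times> \<rat> :: (real \<times> real) set)" by (intro countable_SIGMA countable_rat)
  then have "countable ?R" by (rule countable_subset[of ?R, rotated]) auto
  then have "negligible (\<Union>(?O ` ?R))"
    using negligible_oscillating_derivative[OF assms] by (intro negligible_countable_Union) auto
  then have "negligible (?E \<union> \<Union>(?O ` ?R))"
    using negligible_infinite_derivative[OF assms] by (intro negligible_Un)
  moreover have "?N \<subseteq> ?E \<union> \<Union>(?O ` ?R)"
  proof
    fix t assume t: "t \<in> ?N"
    have nonneg: "0 \<le> diff_quot h t 1 s" for s
      using assms by (cases "s \<ge> 0") (auto simp: diff_quot_def monoD divide_le_0_iff zero_le_divide_iff)
    show "t \<in> ?E \<union> \<Union>(?O ` ?R)"
    proof (rule ccontr)
      assume out: "t \<notin> ?E \<union> \<Union>(?O ` ?R)"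
      then obtain B where "eventually (\<lambda>s. diff_quot h t 1 s \<le> B) (at 0)"
        by (auto simp: frequently_def not_less)
      then have "\<exists>d. (diff_quot h t 1 \<longlongrightarrow> d) (at 0)"
      proof (rule limit_if_no_crossings[rotated 2, where A = 0])
        fix a b :: real assume ab: "a \<in> \<rat>" "b \<in> \<rat>" "a < b"
        show "\<not> ((\<exists>\<^sub>F s in at 0. diff_quot h t 1 s < a) \<and> (\<exists>\<^sub>F s in at 0. b < diff_quot h t 1 s))"
        proof (cases "a > 0")
          case True
          then have "(a, b) \<in> ?R" using ab by blast
          then show ?thesis using out by blast
        next
          case False
          then have "\<not> diff_quot h t 1 s < a" for s using nonneg[of s] by linarith
          then show ?thesis by (simp add: frequently_def)
        qed
      qed (auto simp: nonneg)
      then show False using t by blast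
    qed
  qed
  ultimately show ?thesis by (rule negligible_subset)
qed

section \<open>Difference quotients of functions increasing along a cone\<close>

lemma cone_increasingD:
  assumes "cone_increasing K F" "y - x \<in> K"
  shows "F x \<le> F y"
  using assms by (simp add: cone_increasing_def cone_le_def)

text \<open>The point reflection keeps the class of increasing functions and turns quotients at scale \<open>s\<close> into
  quotients at scale \<open>- s\<close>. Estimates for \<open>s > 0\<close> thereby imply those for \<open>s < 0\<close>.\<close>

lemma cone_increasing_reflect:
  assumes "cone_increasing K F"
  shows "cone_increasing K (\<lambda>y. - F (- y))"
  using assms unfolding cone_increasing_def cone_le_def by (simp add: diff_minus_eq_add)

lemma diff_quot_reflect: "diff_quot (\<lambda>y. - F (- y)) (- x) u s = diff_quot F x u (- s)"
  by (simp add: diff_quot_def divide_minus_right minus_divide_left)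

lemma diff_quot_uminus: "diff_quot F x (- u) s = - diff_quot F x u (- s)"
  by (simp add: diff_quot_def divide_minus_right)

lemma diff_quot_scaleR: "c \<noteq> 0 \<Longrightarrow> diff_quot F x (c *\<^sub>R u) s = c * diff_quot F x u (c * s)"
  by (simp add: diff_quot_def mult.commute)

text \<open>The quantitative form of interiority: in the order of the cone, errors of norm at most \<open>c s\<close> are
  absorbed by \<open>s w\<close>.\<close>

lemma interior_cone_cushion:
  fixes K :: "'a::real_normed_vector set"
  assumes "cone K" "w \<in> interior K"
  obtains c where "0 < c" "\<And>s y. 0 \<le> s \<Longrightarrow> norm y \<le> c * s \<Longrightarrow> s *\<^sub>R w + y \<in> K"
proof -
  obtain c where c: "0 < c" "cball w c \<subseteq> K"
    using assms(2) by (meson mem_interior_cball)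
  have "s *\<^sub>R w + y \<in> K" if "0 \<le> s" "norm y \<le> c * s" for s y
  proof (cases "s = 0")
    case True
    have "0 *\<^sub>R w \<in> K" using assms by (meson cone_def interior_subset order_refl subsetD)
    then show ?thesis using True that by simp
  next
    case False
    then have "s > 0" using that by simp
    then have "w + (1 / s) *\<^sub>R y \<in> cball w c"
      using that(2) by (simp add: dist_norm field_simps)
    then have "s *\<^sub>R (w + (1 / s) *\<^sub>R y) \<in> K"
      using c(2) assms(1) that(1) by (meson cone_def subsetD)
    then show ?thesis using False by (simp add: scaleR_add_right)
  qed
  with c(1) show thesis by (rule that)
qed

lemma interior_cone_scaleR:
  fixes K :: "'a::real_normed_vector set"
  assumes "cone K" "w \<in> interior K" "0 < a"
  shows "a *\<^sub>R w \<in> interior K"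
proof -
  obtain c where c: "0 < c" "\<And>s y. 0 \<le> s \<Longrightarrow> norm y \<le> c * s \<Longrightarrow> s *\<^sub>R w + y \<in> K"
    using interior_cone_cushion[OF assms(1,2)] by blast
  have "cball (a *\<^sub>R w) (c * a) \<subseteq> K"
  proof
    fix z assume "z \<in> cball (a *\<^sub>R w) (c * a)"
    then have "a *\<^sub>R w + (z - a *\<^sub>R w) \<in> K"
      using \<open>0 < a\<close> by (intro c(2)) (auto simp: dist_norm norm_minus_commute)
    then show "z \<in> K" by simp
  qed
  then show ?thesis using c(1) \<open>0 < a\<close> by (meson mem_interior_cball mult_pos_pos)
qed

lemma interior_cone_add:
  fixes K :: "'a::real_normed_vector set"
  assumes "convex K" "cone K" "x \<in> interior K" "y \<in> K"
  shows "x + y \<in> interior K"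
proof -
  obtain c where c: "0 < c" "cball x c \<subseteq> K" using assms(3) by (meson mem_interior_cball)
  have add: "a + b \<in> K" if "a \<in> K" "b \<in> K" for a b
    using assms(1,2) that convex_cone by blast
  have "cball (x + y) c \<subseteq> K"
  proof
    fix z assume "z \<in> cball (x + y) c"
    then have "z - y \<in> cball x c" by (simp add: dist_norm algebra_simps)
    then have "(z - y) + y \<in> K" using c(2) assms(4) by (intro add) auto
    then show "z \<in> K" by simp
  qed
  with c(1) show ?thesis by (meson mem_interior_cball)
qed

text \<open>A real scale \<open>s\<close> is compared with rational scales \<open>r > s\<close> close to it. The gap between \<open>z\<close> and \<open>z'\<close>
  absorbs the error \<open>(r - s) z'\<close>, and the bound \<open>b r\<close> tends to \<open>b s\<close>.\<close>

lemma diff_quot_upper_transfer_pos: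
  assumes F: "cone_increasing K F" and "cone K" and z: "z' - z \<in> interior K"
    and ub: "\<And>r. r \<in> \<rat> \<Longrightarrow> 0 < r \<Longrightarrow> r < \<eta> \<Longrightarrow> diff_quot F x z' r \<le> b"
    and s: "0 < s" "s < \<eta>"
  shows "diff_quot F x z s \<le> b"
proof (rule field_le_epsilon)
  fix e :: real assume "e > 0"
  obtain c where c: "0 < c" "\<And>\<sigma> y. 0 \<le> \<sigma> \<Longrightarrow> norm y \<le> c * \<sigma> \<Longrightarrow> \<sigma> *\<^sub>R (z' - z) + y \<in> K"
    using interior_cone_cushion[OF assms(2,3)] by blast
  \<comment> \<open>The three bounds keep \<open>r\<close> below \<open>\<eta>\<close>, the error \<open>(r - s) z'\<close> absorbable, and \<open>b r\<close> within \<open>e s\<close>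
    of \<open>b s\<close>.\<close>
  define m where "m = min (\<eta> - s) (min (c * s / (norm z' + 1)) (e * s / (\<bar>b\<bar> + 1)))"
  have "m > 0" using s c(1) \<open>e > 0\<close> by (simp add: m_def add_nonneg_pos)
  then obtain r where r: "r \<in> \<rat>" "s < r" "r < s + m" using Rats_dense_in_real[of s "s + m"] by auto
  have "norm ((r - s) *\<^sub>R z') \<le> (c * s / (norm z' + 1)) * (norm z' + 1)"
    using r s c(1) unfolding norm_scaleR by (intro mult_mono) (auto simp: m_def)
  also have "\<dots> = c * s" by (simp add: add_nonneg_eq_0_iff)
  finally have "s *\<^sub>R (z' - z) + (r - s) *\<^sub>R z' \<in> K" using s by (intro c(2)) auto
  then have "F (x + s *\<^sub>R z) \<le> F (x + r *\<^sub>R z')"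
    by (intro cone_increasingD[OF F]) (simp add: algebra_simps)
  moreover have "F (x + r *\<^sub>R z') - F x \<le> b * r"
    using ub[of r] r s by (simp add: m_def diff_quot_def divide_le_eq)
  moreover have "b * r \<le> b * s + e * s"
  proof -
    have "b * (r - s) \<le> \<bar>b\<bar> * (r - s)" using r by (intro mult_right_mono) auto
    also have "\<dots> \<le> (\<bar>b\<bar> + 1) * (e * s / (\<bar>b\<bar> + 1))" using r by (intro mult_mono) (auto simp: m_def)
    also have "\<dots> = e * s" by (simp add: add_nonneg_eq_0_iff)
    finally show ?thesis by (simp add: algebra_simps)
  qed
  ultimately show "diff_quot F x z s \<le> b + e"
    using s by (simp add: diff_quot_def divide_le_eq algebra_simps)
qed

lemma diff_quot_upper_transfer:
  assumes F: "cone_increasing K F" and "cone K" and z: "z' - z \<in> interior K"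
    and ub: "\<And>r. r \<in> \<rat> \<Longrightarrow> r \<noteq> 0 \<Longrightarrow> \<bar>r\<bar> < \<eta> \<Longrightarrow> diff_quot F x z' r \<le> b"
    and s: "s \<noteq> 0" "\<bar>s\<bar> < \<eta>"
  shows "diff_quot F x z s \<le> b"
proof (cases "s > 0")
  case True
  then show ?thesis using s ub by (intro diff_quot_upper_transfer_pos[OF F assms(2) z, of \<eta>]) auto
next
  case False
  have "diff_quot (\<lambda>y. - F (- y)) (- x) z (- s) \<le> b"
    using False s ub
    by (intro diff_quot_upper_transfer_pos[OF cone_increasing_reflect[OF F] assms(2) z, of \<eta>])
      (auto simp: diff_quot_reflect)
  then show ?thesis by (simp add: diff_quot_reflect)
qed

lemma eventually_diff_quot_le:
  assumes F: "cone_increasing K F" and "cone K" and z: "z' - z \<in> interior K"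
    and ub: "\<forall>\<^sub>F r in at 0 within \<rat>. diff_quot F x z' r \<le> b"
  shows "\<forall>\<^sub>F s in at 0. diff_quot F x z s \<le> b"
proof -
  obtain \<eta> where "\<eta> > 0" "\<And>r. r \<in> \<rat> \<Longrightarrow> r \<noteq> 0 \<Longrightarrow> \<bar>r\<bar> < \<eta> \<Longrightarrow> diff_quot F x z' r \<le> b"
    using ub unfolding eventually_at by (auto simp: dist_real_def)
  then have "diff_quot F x z s \<le> b" if "s \<noteq> 0" "\<bar>s\<bar> < \<eta>" for s
    using diff_quot_upper_transfer[OF F assms(2) z _ that] by blast
  then show ?thesis
    unfolding eventually_at using \<open>\<eta> > 0\<close> by (intro exI[of _ \<eta>]) (auto simp: dist_real_def)
qed

lemma eventually_diff_quot_ge: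
  assumes F: "cone_increasing K F" and "cone K" and z: "z - z' \<in> interior K"
    and lb: "\<forall>\<^sub>F r in at 0 within \<rat>. a \<le> diff_quot F x z' r"
  shows "\<forall>\<^sub>F s in at 0. a \<le> diff_quot F x z s"
proof -
  obtain \<eta> where \<eta>: "\<eta> > 0" "\<And>r. r \<in> \<rat> \<Longrightarrow> r \<noteq> 0 \<Longrightarrow> \<bar>r\<bar> < \<eta> \<Longrightarrow> a \<le> diff_quot F x z' r"
    using lb unfolding eventually_at by (auto simp: dist_real_def)
  have "(- z') - (- z) \<in> interior K" using z by simp
  then have "diff_quot F x (- z) s \<le> - a" if "s \<noteq> 0" "\<bar>s\<bar> < \<eta>" for s
    by (rule diff_quot_upper_transfer[OF F assms(2) _ _ that]) (use \<eta>(2) in \<open>auto simp: diff_quot_uminus\<close>)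
  then have "a \<le> diff_quot F x z s" if "s \<noteq> 0" "\<bar>s\<bar> < \<eta>" for s
    using that by (metis abs_minus_cancel diff_quot_uminus minus_le_iff minus_minus neg_equal_0_iff_equal)
  then show ?thesis
    unfolding eventually_at using \<eta>(1) by (intro exI[of _ \<eta>]) (auto simp: dist_real_def)
qed

text \<open>Only rational scales are used, so that this is a Borel condition on the point. Later arguments
  recover real scales by monotonicity.\<close>

definition bracketed :: "('a::real_normed_vector \<Rightarrow> real) \<Rightarrow> 'a \<Rightarrow> 'a \<Rightarrow> real \<Rightarrow> real \<Rightarrow> nat \<Rightarrow> bool" where
  "bracketed F x u a b n \<longleftrightarrow>
     (\<forall>r\<in>\<rat>. r \<noteq> 0 \<and> \<bar>r\<bar> < 1 / (real n + 1) \<longrightarrow> a \<le> diff_quot F x u r \<and> diff_quot F x u r \<le> b)"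

lemma ex_bracketed_iff:
  "(\<exists>n. bracketed F x u a b n) \<longleftrightarrow>
     (\<forall>\<^sub>F r in at 0 within \<rat>. a \<le> diff_quot F x u r \<and> diff_quot F x u r \<le> b)"
proof
  assume "\<exists>n. bracketed F x u a b n"
  then obtain n where "bracketed F x u a b n" ..
  then show "\<forall>\<^sub>F r in at 0 within \<rat>. a \<le> diff_quot F x u r \<and> diff_quot F x u r \<le> b"
    unfolding eventually_at bracketed_def
    by (intro exI[of _ "1 / (real n + 1)"]) (auto simp: dist_real_def add_nonneg_pos)
next
  assume "\<forall>\<^sub>F r in at 0 within \<rat>. a \<le> diff_quot F x u r \<and> diff_quot F x u r \<le> b"
  then obtain \<eta> where \<eta>: "\<eta> > 0"
    "\<And>r. r \<in> \<rat> \<Longrightarrow> r \<noteq> 0 \<Longrightarrow> \<bar>r\<bar> < \<eta> \<Longrightarrow> a \<le> diff_quot F x u r \<and> diff_quot F x u r \<le> b"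
    unfolding eventually_at by (auto simp: dist_real_def)
  obtain n where "inverse (real (Suc n)) < \<eta>" using reals_Archimedean[OF \<eta>(1)] by blast
  then have "1 / (real n + 1) < \<eta>" by (simp add: inverse_eq_divide add.commute)
  then have "bracketed F x u a b n" unfolding bracketed_def using \<eta>(2) by auto
  then show "\<exists>n. bracketed F x u a b n" ..
qed

lemma bracketed_antimono:
  assumes "bracketed F x u a b m" "m \<le> n"
  shows "bracketed F x u a b n"
proof -
  have "1 / (real n + 1) \<le> 1 / (real m + 1)" using assms(2) by (intro divide_left_mono) auto
  then show ?thesis using assms(1) unfolding bracketed_def by force
qed

lemma pred_Bex_countable:
  assumes "countable X" "\<And>i. i \<in> X \<Longrightarrow> Measurable.pred M (P i)"
  shows "Measurable.pred M (\<lambda>x. \<exists>i\<in>X. P i x)"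
proof -
  have "{x \<in> space M. \<exists>i\<in>X. P i x} = (\<Union>i\<in>X. {x \<in> space M. P i x})" by blast
  also have "\<dots> \<in> sets M"
    using assms unfolding pred_def by (intro sets.countable_UN'')
  finally show ?thesis by (simp add: pred_def)
qed

lemma pred_Ball_countable:
  assumes "countable X" "\<And>i. i \<in> X \<Longrightarrow> Measurable.pred M (P i)"
  shows "Measurable.pred M (\<lambda>x. \<forall>i\<in>X. P i x)"
proof -
  have "Measurable.pred M (\<lambda>x. \<not> (\<exists>i\<in>X. \<not> P i x))"
    by (intro pred_intros_logic pred_Bex_countable assms)
  then show ?thesis by simp
qed

lemma borel_bracketed [measurable]:
  fixes F :: "'a::real_normed_vector \<Rightarrow> real"
  assumes F[measurable]: "F \<in> borel_measurable borel"
  shows "Measurable.pred borel (\<lambda>x. bracketed F x u a b n)"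
proof -
  have [measurable]: "(\<lambda>x. F (x + r *\<^sub>R u)) \<in> borel_measurable borel" for r
    by (rule measurable_compose[OF _ F]) (intro borel_measurable_continuous_onI continuous_intros)
  show ?thesis
    unfolding bracketed_def diff_quot_def
    by (rule pred_Ball_countable[OF countable_rat]) measurable
qed

section \<open>Exceptional sets\<close>

text \<open>The members of \<open>C_tilde\<close> are Borel, which is awkward in covering arguments. This is the \<open>\<sigma>\<close>-ideal of
  arbitrary subsets of such sets; Borel measurability is restored only at the end.\<close>

definition exceptional :: "'a::real_normed_vector set \<Rightarrow> bool" where
  "exceptional N \<longleftrightarrow> (\<exists>A :: nat \<Rightarrow> 'a set. N \<subseteq> (\<Union>i. A i) \<and>
     (\<forall>i. \<exists>v \<epsilon>. v \<noteq> 0 \<and> 0 < \<epsilon> \<and> A i \<in> A_tilde_eps v \<epsilon>))"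

lemma exceptionalI:
  assumes "v \<noteq> 0" "0 < \<epsilon>" "A \<in> A_tilde_eps v \<epsilon>"
  shows "exceptional A"
  unfolding exceptional_def using assms by (intro exI[of _ "\<lambda>_. A"]) auto

lemma exceptional_subset: "exceptional N \<Longrightarrow> M \<subseteq> N \<Longrightarrow> exceptional M"
  unfolding exceptional_def by (meson order_trans)

lemma exceptional_UN_nat:
  assumes "\<And>k::nat. exceptional (N k)"
  shows "exceptional (\<Union>k. N k)"
proof -
  have "\<forall>k. \<exists>A :: nat \<Rightarrow> 'a set. N k \<subseteq> (\<Union>i. A i) \<and>
     (\<forall>i. \<exists>v \<epsilon>. v \<noteq> 0 \<and> 0 < \<epsilon> \<and> A i \<in> A_tilde_eps v \<epsilon>)"
    using assms unfolding exceptional_def by blast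
  then obtain A :: "nat \<Rightarrow> nat \<Rightarrow> 'a set" where A: "\<And>k. N k \<subseteq> (\<Union>i. A k i)"
    "\<And>k i. \<exists>v \<epsilon>. v \<noteq> 0 \<and> 0 < \<epsilon> \<and> A k i \<in> A_tilde_eps v \<epsilon>"
    by (subst (asm) choice_iff) blast
  define A' where "A' n = A (fst (prod_decode n)) (snd (prod_decode n))" for n
  have "x \<in> (\<Union>n. A' n)" if "x \<in> N k" for x k
  proof -
    obtain i where "x \<in> A k i" using A(1) \<open>x \<in> N k\<close> by blast
    then have "x \<in> A' (prod_encode (k, i))" by (simp add: A'_def)
    then show ?thesis by blast
  qed
  moreover have "\<exists>v \<epsilon>. v \<noteq> 0 \<and> 0 < \<epsilon> \<and> A' n \<in> A_tilde_eps v \<epsilon>" for n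
    unfolding A'_def by (rule A(2))
  ultimately show ?thesis unfolding exceptional_def by (intro exI[of _ A']) blast
qed

lemma exceptional_UN:
  assumes "countable I" "I \<noteq> {}" "\<And>i. i \<in> I \<Longrightarrow> exceptional (N i)"
  shows "exceptional (\<Union>i\<in>I. N i)"
proof -
  have "(\<Union>i\<in>I. N i) = (\<Union>k. N (from_nat_into I k))"
    using UN_from_nat_into assms(1,2) range_from_nat_into[OF assms(2,1)] by (metis image_image)
  then show ?thesis
    using exceptional_UN_nat[of "\<lambda>k. N (from_nat_into I k)"] assms(2,3) from_nat_into by metis
qed

lemma exceptional_Un:
  assumes "exceptional M" "exceptional N"
  shows "exceptional (M \<union> N)"
proof -
  have "exceptional (\<Union>b\<in>{True, False}. if b then M else N)"
    by (rule exceptional_UN) (use assms in auto)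
  then show ?thesis by (simp add: Un_commute)
qed

lemma A_tilde_eps_Int:
  assumes "B \<in> A_tilde_eps v \<epsilon>" "A \<in> sets borel"
  shows "B \<inter> A \<in> A_tilde_eps v \<epsilon>"
proof -
  have "{t. \<phi> t \<in> B \<inter> A} \<in> null_sets lebesgue" if "\<epsilon>-lipschitz_on UNIV (\<lambda>t. \<phi> t - t *\<^sub>R v)" for \<phi> :: "real \<Rightarrow> 'a"
  proof -
    have "negligible {t. \<phi> t \<in> B}"
      using assms(1) that unfolding A_tilde_eps_def negligible_iff_null_sets by blast
    then have "negligible {t. \<phi> t \<in> B \<inter> A}" by (rule negligible_subset) auto
    then show ?thesis by (simp add: negligible_iff_null_sets)
  qed
  then show ?thesis using assms unfolding A_tilde_eps_def by auto
qed

lemma exceptional_borel_in_C_tilde: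
  assumes "exceptional N" "N \<in> sets borel"
  shows "N \<in> C_tilde"
proof -
  obtain A :: "nat \<Rightarrow> 'a set" where A: "N \<subseteq> (\<Union>i. A i)"
    "\<forall>i. \<exists>v \<epsilon>. v \<noteq> 0 \<and> 0 < \<epsilon> \<and> A i \<in> A_tilde_eps v \<epsilon>"
    using assms(1) unfolding exceptional_def by blast
  obtain v where "\<forall>i. \<exists>\<epsilon>. v i \<noteq> 0 \<and> 0 < \<epsilon> \<and> A i \<in> A_tilde_eps (v i) \<epsilon>"
    using choice[OF A(2)] by blast
  then obtain \<epsilon> where v: "\<forall>i. v i \<noteq> 0 \<and> 0 < \<epsilon> i \<and> A i \<in> A_tilde_eps (v i) (\<epsilon> i)"
    using choice[of "\<lambda>i \<epsilon>. v i \<noteq> 0 \<and> 0 < \<epsilon> \<and> A i \<in> A_tilde_eps (v i) \<epsilon>"] by blast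
  have "A i \<inter> N \<in> A_tilde (v i)" for i
    unfolding A_tilde_def using v A_tilde_eps_Int[OF _ assms(2)]
    by (intro CollectI exI[of _ "\<lambda>_. A i \<inter> N"] exI[of _ "\<lambda>_. \<epsilon> i"]) auto
  moreover have "N = (\<Union>i. A i \<inter> N)" using A(1) by blast
  ultimately show ?thesis unfolding C_tilde_def using v
    by (intro CollectI exI[of _ v] exI[of _ "\<lambda>i. A i \<inter> N"]) simp
qed

section \<open>Derivatives in interior directions\<close>

lemma lipschitz_curve_increment:
  fixes \<phi> :: "real \<Rightarrow> 'a::real_normed_vector"
  assumes "\<epsilon>-lipschitz_on UNIV (\<lambda>t. \<phi> t - t *\<^sub>R v)"
  shows "norm (\<phi> (t + s) - \<phi> t - s *\<^sub>R v) \<le> \<epsilon> * \<bar>s\<bar>"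
  using lipschitz_onD[OF assms, of "t + s" t] by (simp add: dist_norm algebra_simps)

text \<open>The point \<open>\<phi> (t + a s)\<close> differs from \<open>\<phi> t + a s w\<close> by at most \<open>c \<kappa> \<bar>s\<bar>\<close> in norm when \<open>0 \<le> a \<le> 2\<close>, and
  this error is absorbed by \<open>\<kappa> \<bar>s\<bar> w\<close>. Therefore \<open>\<phi> t + s w\<close> lies between the points of the curve
  at the times \<open>t + (1 - \<kappa>) s\<close> and \<open>t + (1 + \<kappa>) s\<close>.\<close>

lemma diff_quot_along_curve:
  fixes F :: "'a::real_normed_vector \<Rightarrow> real" and \<phi> :: "real \<Rightarrow> 'a"
  assumes F: "cone_increasing K F"
    and cushion: "\<And>s y. 0 \<le> s \<Longrightarrow> norm y \<le> c * s \<Longrightarrow> s *\<^sub>R w + y \<in> K"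
    and \<kappa>: "0 < \<kappa>" "\<kappa> < 1" and "0 < c"
    and lip: "(c * \<kappa> / 2)-lipschitz_on UNIV (\<lambda>t. \<phi> t - t *\<^sub>R w)"
  shows "mono (\<lambda>t. F (\<phi> t))" 
    and "s \<noteq> 0 \<Longrightarrow> diff_quot F (\<phi> t) w s \<le> (1 + \<kappa>) * diff_quot (\<lambda>t. F (\<phi> t)) t 1 ((1 + \<kappa>) * s)"
    and "s \<noteq> 0 \<Longrightarrow> (1 - \<kappa>) * diff_quot (\<lambda>t. F (\<phi> t)) t 1 ((1 - \<kappa>) * s) \<le> diff_quot F (\<phi> t) w s"
proof -
  note inc = lipschitz_curve_increment[OF lip]
  have eps: "c * \<kappa> / 2 * ((1 + \<kappa>) * \<bar>s\<bar>) \<le> c * (\<kappa> * \<bar>s\<bar>)" "c * \<kappa> / 2 * ((1 - \<kappa>) * \<bar>s\<bar>) \<le> c * (\<kappa> * \<bar>s\<bar>)" for s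
  proof -
    have "c * \<kappa> / 2 * (a * \<bar>s\<bar>) \<le> c * \<kappa> / 2 * (2 * \<bar>s\<bar>)" if "a \<le> 2" for a
      using that \<kappa> \<open>0 < c\<close> by (intro mult_left_mono mult_right_mono) auto
    from this[of "1 + \<kappa>"] this[of "1 - \<kappa>"] 
    show "c * \<kappa> / 2 * ((1 + \<kappa>) * \<bar>s\<bar>) \<le> c * (\<kappa> * \<bar>s\<bar>)" "c * \<kappa> / 2 * ((1 - \<kappa>) * \<bar>s\<bar>) \<le> c * (\<kappa> * \<bar>s\<bar>)"
      using \<kappa> by auto
  qed
  show "mono (\<lambda>t. F (\<phi> t))"
  proof (rule monoI)
    fix t t' :: real assume "t \<le> t'"
    let ?e = "\<phi> (t + (t' - t)) - \<phi> t - (t' - t) *\<^sub>R w"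
    have "norm ?e \<le> c * \<kappa> / 2 * \<bar>t' - t\<bar>" by (rule inc)
    also have "\<dots> = c * (\<kappa> / 2) * (t' - t)" using \<open>t \<le> t'\<close> by simp
    also have "\<dots> \<le> c * 1 * (t' - t)"
      using \<kappa> \<open>0 < c\<close> \<open>t \<le> t'\<close> by (intro mult_right_mono mult_left_mono) auto
    finally have "(t' - t) *\<^sub>R w + ?e \<in> K" using \<open>t \<le> t'\<close> by (intro cushion) simp_all
    then show "F (\<phi> t) \<le> F (\<phi> t')" by (intro cone_increasingD[OF F]) simp
  qed
  assume "s \<noteq> 0"
  define e1 where "e1 = \<phi> (t + (1 + \<kappa>) * s) - \<phi> t - ((1 + \<kappa>) * s) *\<^sub>R w"
  define e2 where "e2 = \<phi> (t + (1 - \<kappa>) * s) - \<phi> t - ((1 - \<kappa>) * s) *\<^sub>R w"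
  have e: "norm e1 \<le> c * (\<kappa> * \<bar>s\<bar>)" "norm e2 \<le> c * (\<kappa> * \<bar>s\<bar>)"
    using inc[of t "(1 + \<kappa>) * s"] inc[of t "(1 - \<kappa>) * s"] eps[of s] \<kappa>
    by (auto simp: e1_def e2_def abs_mult)
  have K: "(\<kappa> * \<bar>s\<bar>) *\<^sub>R w + e1 \<in> K" "(\<kappa> * \<bar>s\<bar>) *\<^sub>R w - e1 \<in> K" "(\<kappa> * \<bar>s\<bar>) *\<^sub>R w + e2 \<in> K" "(\<kappa> * \<bar>s\<bar>) *\<^sub>R w - e2 \<in> K"
    using cushion[of "\<kappa> * \<bar>s\<bar>" e1] cushion[of "\<kappa> * \<bar>s\<bar>" "- e1"]
      cushion[of "\<kappa> * \<bar>s\<bar>" e2] cushion[of "\<kappa> * \<bar>s\<bar>" "- e2"] e \<kappa> by auto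
  have scale: "(1 + \<kappa>) * diff_quot (\<lambda>t. F (\<phi> t)) t 1 ((1 + \<kappa>) * s) = (F (\<phi> (t + (1 + \<kappa>) * s)) - F (\<phi> t)) / s"
    "(1 - \<kappa>) * diff_quot (\<lambda>t. F (\<phi> t)) t 1 ((1 - \<kappa>) * s) = (F (\<phi> (t + (1 - \<kappa>) * s)) - F (\<phi> t)) / s"
    using \<kappa> by (auto simp: diff_quot_def)
  have "diff_quot F (\<phi> t) w s \<le> (1 + \<kappa>) * diff_quot (\<lambda>t. F (\<phi> t)) t 1 ((1 + \<kappa>) * s)
     \<and> (1 - \<kappa>) * diff_quot (\<lambda>t. F (\<phi> t)) t 1 ((1 - \<kappa>) * s) \<le> diff_quot F (\<phi> t) w s"
  proof (cases "s > 0")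
    case True
    have "F (\<phi> t + s *\<^sub>R w) \<le> F (\<phi> (t + (1 + \<kappa>) * s))"
      using K(1) True by (intro cone_increasingD[OF F]) (simp add: e1_def algebra_simps)
    moreover have "F (\<phi> (t + (1 - \<kappa>) * s)) \<le> F (\<phi> t + s *\<^sub>R w)"
      using K(4) True by (intro cone_increasingD[OF F]) (simp add: e2_def algebra_simps)
    ultimately show ?thesis
      unfolding scale using True by (auto simp: diff_quot_def intro!: divide_right_mono)
  next
    case False
    with \<open>s \<noteq> 0\<close> have "s < 0" by simp
    have "F (\<phi> (t + (1 + \<kappa>) * s)) \<le> F (\<phi> t + s *\<^sub>R w)"
      using K(2) \<open>s < 0\<close> by (intro cone_increasingD[OF F]) (simp add: e1_def algebra_simps)
    moreover have "F (\<phi> t + s *\<^sub>R w) \<le> F (\<phi> (t + (1 - \<kappa>) * s))"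
      using K(3) \<open>s < 0\<close> by (intro cone_increasingD[OF F]) (simp add: e2_def algebra_simps)
    ultimately show ?thesis
      unfolding scale using \<open>s < 0\<close> by (auto simp: diff_quot_def intro!: divide_right_mono_neg)
  qed
  then show "diff_quot F (\<phi> t) w s \<le> (1 + \<kappa>) * diff_quot (\<lambda>t. F (\<phi> t)) t 1 ((1 + \<kappa>) * s)"
    and "(1 - \<kappa>) * diff_quot (\<lambda>t. F (\<phi> t)) t 1 ((1 - \<kappa>) * s) \<le> diff_quot F (\<phi> t) w s" by blast+
qed

lemma bracketed_along_curve:
  fixes F :: "'a::real_normed_vector \<Rightarrow> real" and \<phi> :: "real \<Rightarrow> 'a"
  assumes F: "cone_increasing K F"
    and cushion: "\<And>s y. 0 \<le> s \<Longrightarrow> norm y \<le> c * s \<Longrightarrow> s *\<^sub>R w + y \<in> K"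
    and \<kappa>: "0 < \<kappa>" "\<kappa> < 1" and "0 < c"
    and lip: "(c * \<kappa> / 2)-lipschitz_on UNIV (\<lambda>t. \<phi> t - t *\<^sub>R w)"
    and d: "(diff_quot (\<lambda>t. F (\<phi> t)) t 1 \<longlongrightarrow> d) (at 0)" and "0 < e"
  shows "\<exists>n. bracketed F (\<phi> t) w ((1 - \<kappa>) * (d - e)) ((1 + \<kappa>) * (d + e)) n"
proof -
  have "\<forall>\<^sub>F s in at 0. dist (diff_quot (\<lambda>t. F (\<phi> t)) t 1 s) d < e"
    using tendstoD[OF d \<open>0 < e\<close>] .
  then obtain \<eta> where \<eta>: "\<eta> > 0" 
    "\<And>s. s \<noteq> 0 \<Longrightarrow> \<bar>s\<bar> < \<eta> \<Longrightarrow> \<bar>diff_quot (\<lambda>t. F (\<phi> t)) t 1 s - d\<bar> < e"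
    unfolding eventually_at by (auto simp: dist_real_def)
  have "(1 - \<kappa>) * (d - e) \<le> diff_quot F (\<phi> t) w s \<and> diff_quot F (\<phi> t) w s \<le> (1 + \<kappa>) * (d + e)"
    if s: "s \<noteq> 0" "\<bar>s\<bar> < \<eta> / 2" for s
  proof -
    have "\<bar>(1 + \<kappa>) * s\<bar> < \<eta>" "\<bar>(1 - \<kappa>) * s\<bar> < \<eta>"
    proof -
      have "a * \<bar>s\<bar> \<le> 2 * \<bar>s\<bar>" if "a \<le> 2" for a using that by (intro mult_right_mono) auto
      from this[of "1 + \<kappa>"] this[of "1 - \<kappa>"] s(2) \<kappa>
      show "\<bar>(1 + \<kappa>) * s\<bar> < \<eta>" "\<bar>(1 - \<kappa>) * s\<bar> < \<eta>" by (auto simp: abs_mult)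
    qed
    then have q: "\<bar>diff_quot (\<lambda>t. F (\<phi> t)) t 1 ((1 + \<kappa>) * s) - d\<bar> < e" "\<bar>diff_quot (\<lambda>t. F (\<phi> t)) t 1 ((1 - \<kappa>) * s) - d\<bar> < e"
      using s(1) \<kappa> by (auto intro!: \<eta>(2))
    have "diff_quot F (\<phi> t) w s \<le> (1 + \<kappa>) * diff_quot (\<lambda>t. F (\<phi> t)) t 1 ((1 + \<kappa>) * s)"
      by (rule diff_quot_along_curve(2)[OF F cushion \<kappa> \<open>0 < c\<close> lip s(1)])
    also have "\<dots> \<le> (1 + \<kappa>) * (d + e)" using q(1) \<kappa> by (intro mult_left_mono) auto
    finally have 1: "diff_quot F (\<phi> t) w s \<le> (1 + \<kappa>) * (d + e)" .
    have "(1 - \<kappa>) * (d - e) \<le> (1 - \<kappa>) * diff_quot (\<lambda>t. F (\<phi> t)) t 1 ((1 - \<kappa>) * s)"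
      using q(2) \<kappa> by (intro mult_left_mono) auto
    also have "\<dots> \<le> diff_quot F (\<phi> t) w s"
      by (rule diff_quot_along_curve(3)[OF F cushion \<kappa> \<open>0 < c\<close> lip s(1)])
    finally show ?thesis using 1 by blast
  qed
  then show ?thesis
    unfolding ex_bracketed_iff eventually_at using \<eta>(1)
    by (intro exI[of _ "\<eta> / 2"]) (auto simp: dist_real_def)
qed

text \<open>Almost every point of a test curve satisfies the bracketing condition for some \<open>d\<close>, namely for the
  derivative of \<open>F\<close> along the curve.\<close>

lemma in_A_tilde_eps_if_derivative_excludes:
  fixes F :: "'a::real_normed_vector \<Rightarrow> real" and B :: "'a set"
  assumes F: "cone_increasing K F"
    and cushion: "\<And>s y. 0 \<le> s \<Longrightarrow> norm y \<le> c * s \<Longrightarrow> s *\<^sub>R w + y \<in> K"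
    and \<kappa>: "0 < \<kappa>" "\<kappa> < 1" and "0 < c" and B: "B \<in> sets borel" and "0 < e"
    and excl: "\<And>x d. \<exists>n. bracketed F x w ((1 - \<kappa>) * (d - e)) ((1 + \<kappa>) * (d + e)) n \<Longrightarrow> x \<notin> B"
  shows "B \<in> A_tilde_eps w (c * \<kappa> / 2)"
proof -
  have "{t. \<phi> t \<in> B} \<in> null_sets lebesgue"
    if lip: "(c * \<kappa> / 2)-lipschitz_on UNIV (\<lambda>t. \<phi> t - t *\<^sub>R w)" for \<phi> :: "real \<Rightarrow> 'a"
  proof -
    let ?h = "\<lambda>t. F (\<phi> t)"
    have "mono ?h" by (rule diff_quot_along_curve(1)[OF F cushion \<kappa> \<open>0 < c\<close> lip])
    then have "negligible {t. \<not> (\<exists>d. (diff_quot ?h t 1 \<longlongrightarrow> d) (at 0))}"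
      by (rule Lebesgue_monotone_differentiable)
    moreover have "{t. \<phi> t \<in> B} \<subseteq> {t. \<not> (\<exists>d. (diff_quot ?h t 1 \<longlongrightarrow> d) (at 0))}"
      using excl bracketed_along_curve[OF F cushion \<kappa> \<open>0 < c\<close> lip _ \<open>0 < e\<close>] by blast
    ultimately show ?thesis
      unfolding negligible_iff_null_sets[symmetric] by (rule negligible_subset)
  qed
  then show ?thesis using B unfolding A_tilde_eps_def by blast
qed

text \<open>The brackets obtained along a curve have width about \<open>2 \<kappa> d\<close>, which depends on the derivative \<open>d\<close>.
  The points are therefore sorted by an integer bound \<open>m\<close> on their quotients, which also bounds \<open>d\<close>,
  and \<open>\<kappa>\<close> is chosen depending on \<open>m\<close>. Points without such a bound are treated separately, with
  \<open>\<kappa> = 1/2\<close>.\<close>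

theorem exceptional_unbracketed:
  fixes F :: "'a::real_normed_vector \<Rightarrow> real"
  assumes F: "cone_increasing K F" and F_borel [measurable]: "F \<in> borel_measurable borel"
    and "cone K" "w \<in> interior K" "w \<noteq> 0" "0 < \<delta>"
  shows "exceptional {x. \<not> (\<exists>p\<in>\<rat>. \<exists>n. bracketed F x w p (p + \<delta>) n)}"
proof -
  obtain c where c: "0 < c" and cushion: "\<And>s y. 0 \<le> s \<Longrightarrow> norm y \<le> c * s \<Longrightarrow> s *\<^sub>R w + y \<in> K"
    using interior_cone_cushion[OF assms(3,4)] by blast
  define B where "B = {x. \<not> (\<exists>m n. bracketed F x w 0 (real m) n)}"
  define B' where "B' m = {x. (\<exists>n. bracketed F x w 0 (real m) n) \<and> \<not> (\<exists>p\<in>\<rat>. \<exists>n. bracketed F x w p (p + \<delta>) n)}" for m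
  have nonneg: "0 \<le> diff_quot F x w r" for x r
  proof (cases "r \<ge> 0")
    case True
    have "F x \<le> F (x + r *\<^sub>R w)" using True cushion[of r 0] c by (intro cone_increasingD[OF F]) auto
    then show ?thesis using True by (simp add: diff_quot_def)
  next
    case False
    have "c * r \<le> 0" using False c by (simp add: mult_nonneg_nonpos)
    then have "F (x + r *\<^sub>R w) \<le> F x" using False cushion[of "-r" 0] by (intro cone_increasingD[OF F]) auto
    then show ?thesis using False by (simp add: diff_quot_def divide_nonpos_nonpos)
  qed
  have "B \<in> A_tilde_eps w (c * (1/2) / 2)"
  proof (rule in_A_tilde_eps_if_derivative_excludes[OF F cushion _ _ c])
    have "Measurable.pred borel (\<lambda>x. \<not> (\<exists>m n. bracketed F x w 0 (real m) n))" by measurable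
    then show "B \<in> sets borel" by (simp add: B_def pred_def)
    fix x d assume "\<exists>n. bracketed F x w ((1 - 1/2) * (d - 1)) ((1 + 1/2) * (d + 1)) n"
    then obtain n where n: "bracketed F x w ((1 - 1/2) * (d - 1)) ((1 + 1/2) * (d + 1)) n" ..
    obtain m where "(1 + 1/2) * (d + 1) \<le> real m" using real_arch_simple by blast
    then have "bracketed F x w 0 (real m) n" using n nonneg unfolding bracketed_def by force
    then show "x \<notin> B" by (auto simp: B_def)
  qed auto
  then have exB: "exceptional B" using assms(5) c by (intro exceptionalI) auto
  have exB': "exceptional (B' m)" for m
  proof -
    \<comment> \<open>These make \<open>2 \<kappa> d + 2 e\<close>, the width of the bracket, less than \<open>\<delta>\<close> as soon as \<open>d \<le> 2 m + 1\<close>.\<close>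
    define e where "e = min 1 (\<delta> / 8)"
    define \<kappa> where "\<kappa> = min (1/2) (\<delta> / (8 * (2 * real m + 1)))"
    have e: "0 < e" "e \<le> 1" "8 * e \<le> \<delta>" using assms(6) by (auto simp: e_def)
    have "0 < \<kappa>" using assms(6) by (simp add: \<kappa>_def add_nonneg_pos)
    have \<kappa>: "\<kappa> \<le> 1/2" "8 * (\<kappa> * (2 * real m + 1)) \<le> \<delta>"
    proof -
      have "\<kappa> \<le> \<delta> / (8 * (2 * real m + 1))" by (simp add: \<kappa>_def)
      then show "8 * (\<kappa> * (2 * real m + 1)) \<le> \<delta>" by (simp add: field_simps add_nonneg_pos)
      show "\<kappa> \<le> 1/2" unfolding \<kappa>_def by (rule min.cobounded1)
    qed
    have "B' m \<in> A_tilde_eps w (c * \<kappa> / 2)"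
    proof (rule in_A_tilde_eps_if_derivative_excludes[OF F cushion \<open>0 < \<kappa>\<close> _ c _ e(1)])
      have "Measurable.pred borel (\<lambda>x. (\<exists>n. bracketed F x w 0 (real m) n) \<and> \<not> (\<exists>p\<in>\<rat>. \<exists>n. bracketed F x w p (p + \<delta>) n))"
        by (intro pred_intros_logic pred_Bex_countable countable_rat) measurable
      then show "B' m \<in> sets borel" by (simp add: B'_def pred_def)
      fix x d assume "\<exists>n. bracketed F x w ((1 - \<kappa>) * (d - e)) ((1 + \<kappa>) * (d + e)) n"
      then obtain n where n: "bracketed F x w ((1 - \<kappa>) * (d - e)) ((1 + \<kappa>) * (d + e)) n" ..
      show "x \<notin> B' m"
      proof
        assume "x \<in> B' m"
        then obtain k where k: "bracketed F x w 0 (real m) k"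
          and no: "\<And>p n. p \<in> \<rat> \<Longrightarrow> \<not> bracketed F x w p (p + \<delta>) n" unfolding B'_def by blast
        obtain r where r: "r \<in> \<rat>" "0 < r" "r < min (1 / (real k + 1)) (1 / (real n + 1))"
          using Rats_dense_in_real[of 0 "min (1 / (real k + 1)) (1 / (real n + 1))"] by auto
        have "(1 - \<kappa>) * (d - e) \<le> diff_quot F x w r" "diff_quot F x w r \<le> real m"
          using n k r unfolding bracketed_def by auto
        then have le: "(1 - \<kappa>) * (d - e) \<le> real m" by linarith
        have d: "d - e \<le> 2 * real m"
        proof (cases "d - e \<ge> 0")
          case True
          have "1/2 * (d - e) \<le> (1 - \<kappa>) * (d - e)" using \<kappa>(1) True by (intro mult_right_mono) auto
          from this le have "1/2 * (d - e) \<le> real m" by (rule order_trans)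
          then show ?thesis by simp
        qed (auto simp: not_le)
        have "\<kappa> * d \<le> \<kappa> * (2 * real m + 1)" using \<open>0 < \<kappa>\<close> d e by (intro mult_left_mono) auto
        then have "(1 + \<kappa>) * (d + e) - (1 - \<kappa>) * (d - e) < \<delta>"
          using \<kappa>(2) e assms(6) by (simp add: algebra_simps)
        then have "(1 + \<kappa>) * (d + e) - \<delta> < (1 - \<kappa>) * (d - e)" by linarith
        then obtain p where p: "p \<in> \<rat>" "(1 + \<kappa>) * (d + e) - \<delta> < p" "p < (1 - \<kappa>) * (d - e)"
          using Rats_dense_in_real by blast
        then have "bracketed F x w p (p + \<delta>) n" using n unfolding bracketed_def by force
        then show False using no p(1) by blast
      qed
    qed (use \<kappa> in auto)
    then show ?thesis using assms(5) c \<open>0 < \<kappa>\<close> by (intro exceptionalI) auto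
  qed
  have "exceptional (B \<union> (\<Union>m. B' m))"
    by (intro exceptional_Un exB exceptional_UN_nat exB')
  then show ?thesis
    by (rule exceptional_subset) (auto simp: B_def B'_def)
qed

section \<open>Derivatives in differences of interior directions\<close>

text \<open>The point \<open>x + s (w - v)\<close> is reached from \<open>x\<close> by the step \<open>- s v\<close> to \<open>y\<close>, up to an error, followed by
  the step \<open>s w\<close>. Changing the step lengths by the factors \<open>1 - \<kappa>\<close> and \<open>1 + \<kappa>\<close> absorbs the error in
  the order of the cone; the bound on \<open>\<kappa>\<close> makes the cost at most another \<open>\<delta>\<close>.\<close>

lemma diff_quot_of_difference_pos:
  fixes F :: "'a::real_normed_vector \<Rightarrow> real"
  assumes F: "cone_increasing K F"
    and cw: "\<And>s y. 0 \<le> s \<Longrightarrow> norm y \<le> c * s \<Longrightarrow> s *\<^sub>R w + y \<in> K"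
    and cv: "\<And>s y. 0 \<le> s \<Longrightarrow> norm y \<le> c * s \<Longrightarrow> s *\<^sub>R v + y \<in> K"
    and \<kappa>: "0 < \<kappa>" "\<kappa> < 1" "\<kappa> * (\<bar>p\<bar> + \<bar>q\<bar> + \<delta>) \<le> \<delta>"
    and "0 < \<delta>" and near: "norm (y - (x - s *\<^sub>R v)) \<le> c * (\<kappa> * s)" and "0 < s"
    and qw: "p \<le> diff_quot F y w ((1 - \<kappa>) * s)" "diff_quot F y w ((1 + \<kappa>) * s) \<le> p + \<delta>"
    and qv: "q \<le> diff_quot F x v (- ((1 - \<kappa>) * s))" "diff_quot F x v (- ((1 + \<kappa>) * s)) \<le> q + \<delta>"
  shows "p - q - 2 * \<delta> \<le> diff_quot F x (w - v) s \<and> diff_quot F x (w - v) s \<le> p - q + 2 * \<delta>"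
proof -
  define e where "e = y - (x - s *\<^sub>R v)"
  have ks: "0 \<le> \<kappa> * s" using \<kappa> \<open>0 < s\<close> by simp
  have K: "(\<kappa> * s) *\<^sub>R w + e \<in> K" "(\<kappa> * s) *\<^sub>R w - e \<in> K" "(\<kappa> * s) *\<^sub>R v + e \<in> K" "(\<kappa> * s) *\<^sub>R v - e \<in> K"
    using cw[OF ks, of e] cw[OF ks, of "- e"] cv[OF ks, of e] cv[OF ks, of "- e"] near
    by (simp_all flip: e_def)
  have pos: "0 < (1 - \<kappa>) * s" "0 < (1 + \<kappa>) * s" using \<kappa> \<open>0 < s\<close> by auto
  have increment: "diff_quot F x v (- a) * a = F x - F (x + (- a) *\<^sub>R v)" if "0 < a" for a
    using that by (simp add: diff_quot_def)
  have absk: "\<bar>\<kappa> * (p + q + \<delta>)\<bar> \<le> \<delta>"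
  proof -
    have "\<bar>p + q + \<delta>\<bar> \<le> \<bar>p\<bar> + \<bar>q\<bar> + \<delta>" using \<open>0 < \<delta>\<close> by linarith
    then have "\<kappa> * \<bar>p + q + \<delta>\<bar> \<le> \<kappa> * (\<bar>p\<bar> + \<bar>q\<bar> + \<delta>)" using \<kappa>(1) by (intro mult_left_mono) auto
    moreover have "\<bar>\<kappa> * (p + q + \<delta>)\<bar> = \<kappa> * \<bar>p + q + \<delta>\<bar>" using \<kappa>(1) by (simp add: abs_mult)
    ultimately show ?thesis using \<kappa>(3) by linarith
  qed
  have "F (x + s *\<^sub>R (w - v)) \<le> F (y + ((1 + \<kappa>) * s) *\<^sub>R w)"
    using K(1) by (intro cone_increasingD[OF F]) (simp add: e_def algebra_simps)
  also have "\<dots> \<le> F y + (p + \<delta>) * ((1 + \<kappa>) * s)"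
    using qw(2) pos by (simp add: diff_quot_def pos_divide_le_eq)
  also have "F y \<le> F (x + (- ((1 - \<kappa>) * s)) *\<^sub>R v)"
    using K(4) by (intro cone_increasingD[OF F]) (simp add: e_def algebra_simps)
  also have "\<dots> \<le> F x - q * ((1 - \<kappa>) * s)"
    using mult_right_mono[OF qv(1), of "(1 - \<kappa>) * s"] pos increment[of "(1 - \<kappa>) * s"] by simp
  finally have "F (x + s *\<^sub>R (w - v)) - F x \<le> s * ((1 + \<kappa>) * (p + \<delta>) - (1 - \<kappa>) * q)"
    by (simp add: algebra_simps)
  also have "\<dots> \<le> s * (p - q + 2 * \<delta>)"
    using absk \<open>0 < s\<close> by (intro mult_left_mono) (auto simp: algebra_simps)
  finally have upper: "diff_quot F x (w - v) s \<le> p - q + 2 * \<delta>"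
    using \<open>0 < s\<close> by (simp add: diff_quot_def pos_divide_le_eq mult.commute)
  have "s * (p - q - 2 * \<delta>) \<le> s * ((1 - \<kappa>) * p - (1 + \<kappa>) * (q + \<delta>))"
    using absk \<open>0 < s\<close> by (intro mult_left_mono) (auto simp: algebra_simps)
  also have "\<dots> = p * ((1 - \<kappa>) * s) + (F x - (q + \<delta>) * ((1 + \<kappa>) * s)) - F x"
    by (simp add: algebra_simps)
  also have "F x - (q + \<delta>) * ((1 + \<kappa>) * s) \<le> F (x + (- ((1 + \<kappa>) * s)) *\<^sub>R v)"
    using mult_right_mono[OF qv(2), of "(1 + \<kappa>) * s"] pos increment[of "(1 + \<kappa>) * s"] by simp
  also have "\<dots> \<le> F y"
    using K(3) by (intro cone_increasingD[OF F]) (simp add: e_def algebra_simps)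
  also have "p * ((1 - \<kappa>) * s) + F y - F x \<le> F (y + ((1 - \<kappa>) * s) *\<^sub>R w) - F x"
    using qw(1) pos by (simp add: diff_quot_def pos_le_divide_eq)
  also have "\<dots> \<le> F (x + s *\<^sub>R (w - v)) - F x"
    using K(2) by (intro diff_right_mono cone_increasingD[OF F]) (simp add: e_def algebra_simps)
  finally have "p - q - 2 * \<delta> \<le> diff_quot F x (w - v) s"
    using \<open>0 < s\<close> by (simp add: diff_quot_def pos_le_divide_eq mult.commute)
  with upper show ?thesis by blast
qed

lemma diff_quot_of_difference:
  fixes F :: "'a::real_normed_vector \<Rightarrow> real"
  assumes F: "cone_increasing K F"
    and cw: "\<And>s y. 0 \<le> s \<Longrightarrow> norm y \<le> c * s \<Longrightarrow> s *\<^sub>R w + y \<in> K"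
    and cv: "\<And>s y. 0 \<le> s \<Longrightarrow> norm y \<le> c * s \<Longrightarrow> s *\<^sub>R v + y \<in> K"
    and \<kappa>: "0 < \<kappa>" "\<kappa> < 1" "\<kappa> * (\<bar>p\<bar> + \<bar>q\<bar> + \<delta>) \<le> \<delta>"
    and "0 < \<delta>" and near: "norm (y - (x - s *\<^sub>R v)) \<le> c * (\<kappa> * \<bar>s\<bar>)" and "s \<noteq> 0"
    and qw: "p \<le> diff_quot F y w ((1 - \<kappa>) * s)" "diff_quot F y w ((1 + \<kappa>) * s) \<le> p + \<delta>"
    and qv: "q \<le> diff_quot F x v (- ((1 - \<kappa>) * s))" "diff_quot F x v (- ((1 + \<kappa>) * s)) \<le> q + \<delta>"
  shows "p - q - 2 * \<delta> \<le> diff_quot F x (w - v) s \<and> diff_quot F x (w - v) s \<le> p - q + 2 * \<delta>"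
proof (cases "s > 0")
  case True
  then show ?thesis
    using assms by (intro diff_quot_of_difference_pos[OF F cw cv \<kappa> \<open>0 < \<delta>\<close> _ _ qw qv]) auto
next
  case False
  let ?G = "\<lambda>y. - F (- y)"
  have "p - q - 2 * \<delta> \<le> diff_quot ?G (- x) (w - v) (- s) \<and> diff_quot ?G (- x) (w - v) (- s) \<le> p - q + 2 * \<delta>"
  proof (rule diff_quot_of_difference_pos[OF cone_increasing_reflect[OF F] cw cv \<kappa> \<open>0 < \<delta>\<close>])
    have "- y - (- x - (- s) *\<^sub>R v) = - (y - (x - s *\<^sub>R v))" by simp
    then show "norm (- y - (- x - (- s) *\<^sub>R v)) \<le> c * (\<kappa> * - s)"
      using near False by (simp only: norm_minus_cancel) simp
  qed (use False \<open>s \<noteq> 0\<close> qw qv in \<open>auto simp: diff_quot_reflect\<close>)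
  then show ?thesis by (simp add: diff_quot_reflect)
qed

text \<open>If the quotient of \<open>x\<close> in direction \<open>w - v\<close> is wrong at scale \<open>s\<close>, then by
  \<open>diff_quot_of_difference\<close> no point of the set is near \<open>x - s v\<close>. A curve close to direction \<open>v\<close>
  passing through \<open>x = \<phi> t\<close> stays near that point during a time interval around \<open>t - s\<close> of length
  proportional to \<open>\<bar>s\<bar>\<close>, so the preimage of the set is porous.\<close>

theorem nonadditive_in_A_tilde_eps:
  fixes F :: "'a::real_normed_vector \<Rightarrow> real"
  assumes F: "cone_increasing K F" and F_borel [measurable]: "F \<in> borel_measurable borel"
    and "cone K" "w \<in> interior K" "v \<in> interior K" "0 < \<delta>"
  shows "\<exists>\<epsilon>>0. {x. bracketed F x w p (p + \<delta>) n \<and> bracketed F x v q (q + \<delta>) n \<and>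
      \<not> (\<exists>m. bracketed F x (w - v) (p - q - 2 * \<delta>) (p - q + 2 * \<delta>) m)} \<in> A_tilde_eps v \<epsilon>"
    (is "\<exists>\<epsilon>>0. ?A \<in> _")
proof -
  obtain c1 where c1: "0 < c1" "\<And>s y. 0 \<le> s \<Longrightarrow> norm y \<le> c1 * s \<Longrightarrow> s *\<^sub>R w + y \<in> K"
    using interior_cone_cushion[OF assms(3,4)] by blast
  obtain c2 where c2: "0 < c2" "\<And>s y. 0 \<le> s \<Longrightarrow> norm y \<le> c2 * s \<Longrightarrow> s *\<^sub>R v + y \<in> K"
    using interior_cone_cushion[OF assms(3,5)] by blast
  define c where "c = min c1 c2"
  have "0 < c" using c1 c2 by (simp add: c_def)
  have cw: "s *\<^sub>R w + y \<in> K" and cv: "s *\<^sub>R v + y \<in> K" if "0 \<le> s" "norm y \<le> c * s" for s y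
  proof -
    have "c * s \<le> c1 * s" "c * s \<le> c2 * s" using that(1) by (auto simp: c_def intro: mult_right_mono)
    then show "s *\<^sub>R w + y \<in> K" "s *\<^sub>R v + y \<in> K" using that by (auto intro: c1(2) c2(2))
  qed
  have "0 < min 1 (\<delta> / (\<bar>p\<bar> + \<bar>q\<bar> + \<delta>))" using assms(6) by (simp add: add_nonneg_pos)
  then obtain \<kappa> where \<kappa>: "\<kappa> \<in> \<rat>" "0 < \<kappa>" "\<kappa> < min 1 (\<delta> / (\<bar>p\<bar> + \<bar>q\<bar> + \<delta>))"
    using Rats_dense_in_real by blast
  have \<kappa>1: "\<kappa> < 1" and "\<kappa> < \<delta> / (\<bar>p\<bar> + \<bar>q\<bar> + \<delta>)" using \<kappa>(3) by auto
  then have \<kappa>2: "\<kappa> * (\<bar>p\<bar> + \<bar>q\<bar> + \<delta>) \<le> \<delta>"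
    using assms(6) by (simp add: pos_less_divide_eq add_nonneg_pos)
  \<comment> \<open>The error budget is \<open>c \<kappa> \<bar>s\<bar>\<close>. Half of it is reserved for the deviation of the curve from direction
    \<open>v\<close>, half for the width \<open>\<rho> \<bar>s\<bar>\<close> of the time interval.\<close>
  define \<epsilon> where "\<epsilon> = c * \<kappa> / 4"
  define \<rho> where "\<rho> = min (1/2) (c * \<kappa> / (2 * (norm v + 1)))"
  have "0 < \<epsilon>" using \<open>0 < c\<close> \<kappa> by (simp add: \<epsilon>_def)
  have \<rho>: "0 < \<rho>" "\<rho> \<le> 1/2"
    using \<open>0 < c\<close> \<kappa> unfolding \<rho>_def by (simp add: add_nonneg_pos, intro min.cobounded1)
  have "\<rho> * (norm v + 1) \<le> c * \<kappa> / (2 * (norm v + 1)) * (norm v + 1)"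
    by (intro mult_right_mono) (auto simp: \<rho>_def)
  also have "\<dots> = c * \<kappa> / 2"
  proof -
    have "norm v + 1 > 0" by (simp add: add_nonneg_pos)
    then show ?thesis by (simp only: times_divide_eq_left frac_eq_eq) (simp add: field_simps)
  qed
  finally have "\<rho> * norm v \<le> c * \<kappa> / 2" using \<rho> by (simp add: algebra_simps)
  moreover have "\<epsilon> * (1 + \<rho>) \<le> \<epsilon> * 2" using \<rho> \<open>0 < \<epsilon>\<close> by (intro mult_left_mono) auto
  moreover have "\<epsilon> * 2 = c * \<kappa> / 2" by (simp add: \<epsilon>_def)
  ultimately have budget: "\<epsilon> * (1 + \<rho>) + \<rho> * norm v \<le> c * \<kappa>" by linarith
  have "{t. \<phi> t \<in> ?A} \<in> null_sets lebesgue"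
    if lip: "\<epsilon>-lipschitz_on UNIV (\<lambda>t. \<phi> t - t *\<^sub>R v)" for \<phi> :: "real \<Rightarrow> 'a"
    unfolding negligible_iff_null_sets[symmetric]
  proof (rule negligible_if_uniformly_porous[OF \<rho>(1)])
    fix t \<eta> :: real assume t: "t \<in> {t. \<phi> t \<in> ?A}" and "0 < \<eta>"
    let ?x = "\<phi> t"
    obtain m where "inverse (real (Suc m)) < min \<eta> (1 / (2 * (real n + 1)))"
      using reals_Archimedean[of "min \<eta> (1 / (2 * (real n + 1)))"] \<open>0 < \<eta>\<close> by (auto simp: add_nonneg_pos)
    then have m: "1 / (real m + 1) < \<eta>" "1 / (real m + 1) < 1 / (2 * (real n + 1))"
      by (auto simp: inverse_eq_divide add.commute)
    have "\<not> bracketed F ?x (w - v) (p - q - 2 * \<delta>) (p - q + 2 * \<delta>) m" using t by blast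
    then obtain s where s: "s \<in> \<rat>" "s \<noteq> 0" "\<bar>s\<bar> < 1 / (real m + 1)"
      and bad: "\<not> (p - q - 2 * \<delta> \<le> diff_quot F ?x (w - v) s \<and> diff_quot F ?x (w - v) s \<le> p - q + 2 * \<delta>)"
      unfolding bracketed_def by blast
    \<comment> \<open>\<open>\<kappa>\<close> and \<open>s\<close> were chosen rational so that the brackets apply to the modified steps.\<close>
    have small: "a * s \<in> \<rat> \<and> a * s \<noteq> 0 \<and> \<bar>a * s\<bar> < 1 / (real n + 1)"
      if "a = 1 - \<kappa> \<or> a = 1 + \<kappa>" for a
    proof -
      have "0 < a" "a < 2" "a \<in> \<rat>" using that \<kappa> \<kappa>1 by auto
      have "\<bar>a * s\<bar> \<le> 2 * \<bar>s\<bar>" using \<open>0 < a\<close> \<open>a < 2\<close> by (auto simp: abs_mult intro!: mult_right_mono)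
      also have "\<dots> < 2 * (1 / (2 * (real n + 1)))" using s(3) m(2) by linarith
      also have "\<dots> = 1 / (real n + 1)" by (simp add: divide_simps)
      finally show ?thesis using \<open>a \<in> \<rat>\<close> \<open>0 < a\<close> s by auto
    qed
    have miss: "\<phi> t' \<notin> ?A" if t': "t' \<in> {t + - s - \<rho> * \<bar>- s\<bar>..t + - s + \<rho> * \<bar>- s\<bar>}" for t'
    proof
      assume A: "\<phi> t' \<in> ?A"
      have dt: "\<bar>t' - t + s\<bar> \<le> \<rho> * \<bar>s\<bar>" using t' by (auto simp: abs_le_iff)
      then have "\<bar>t' - t\<bar> \<le> (1 + \<rho>) * \<bar>s\<bar>" by (simp add: algebra_simps)
      then have n1: "norm (\<phi> (t + (t' - t)) - \<phi> t - (t' - t) *\<^sub>R v) \<le> \<epsilon> * ((1 + \<rho>) * \<bar>s\<bar>)"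
        using lipschitz_curve_increment[OF lip, of t "t' - t"] \<open>0 < \<epsilon>\<close>
        by (meson less_imp_le mult_left_mono order_trans)
      have n2: "norm ((t' - t + s) *\<^sub>R v) \<le> \<rho> * \<bar>s\<bar> * norm v"
        using dt by (simp add: mult_right_mono)
      have eq: "\<phi> t' - (\<phi> t - s *\<^sub>R v) = (\<phi> (t + (t' - t)) - \<phi> t - (t' - t) *\<^sub>R v) + (t' - t + s) *\<^sub>R v"
        by (simp add: algebra_simps)
      have "norm (\<phi> t' - (\<phi> t - s *\<^sub>R v)) \<le> \<epsilon> * ((1 + \<rho>) * \<bar>s\<bar>) + \<rho> * \<bar>s\<bar> * norm v"
        unfolding eq by (rule norm_triangle_mono[OF n1 n2])
      also have "\<dots> = (\<epsilon> * (1 + \<rho>) + \<rho> * norm v) * \<bar>s\<bar>" by (simp add: algebra_simps)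
      also have "\<dots> \<le> c * \<kappa> * \<bar>s\<bar>" using budget by (intro mult_right_mono) auto
      finally have near: "norm (\<phi> t' - (\<phi> t - s *\<^sub>R v)) \<le> c * (\<kappa> * \<bar>s\<bar>)" by (simp add: mult.assoc)
      have bw: "p \<le> diff_quot F (\<phi> t') w r \<and> diff_quot F (\<phi> t') w r \<le> p + \<delta>"
        and bv: "q \<le> diff_quot F ?x v r \<and> diff_quot F ?x v r \<le> q + \<delta>"
        if "r \<in> \<rat> \<and> r \<noteq> 0 \<and> \<bar>r\<bar> < 1 / (real n + 1)" for r
        using A t that unfolding bracketed_def by blast+
      have neg: "- (a * s) \<in> \<rat> \<and> - (a * s) \<noteq> 0 \<and> \<bar>- (a * s)\<bar> < 1 / (real n + 1)"
        if "a = 1 - \<kappa> \<or> a = 1 + \<kappa>" for a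
        using small[OF that] by auto
      have "p - q - 2 * \<delta> \<le> diff_quot F ?x (w - v) s \<and> diff_quot F ?x (w - v) s \<le> p - q + 2 * \<delta>"
        by (rule diff_quot_of_difference[OF F cw cv \<kappa>(2) \<kappa>1 \<kappa>2 assms(6) near s(2)])
          (use bw[OF small] bv[OF neg] in auto)
      then show False using bad by blast
    qed
    show "\<exists>s. 0 < \<bar>s\<bar> \<and> \<bar>s\<bar> < \<eta> \<and> {t + s - \<rho> * \<bar>s\<bar>..t + s + \<rho> * \<bar>s\<bar>} \<inter> {t. \<phi> t \<in> ?A} = {}"
    proof (intro exI[of _ "- s"] conjI)
      show "{t + - s - \<rho> * \<bar>- s\<bar>..t + - s + \<rho> * \<bar>- s\<bar>} \<inter> {t. \<phi> t \<in> ?A} = {}"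
        using miss by blast
    qed (use s m(1) in auto)
  qed (use \<rho> in auto)
  moreover have "Measurable.pred borel (\<lambda>x. bracketed F x w p (p + \<delta>) n \<and> bracketed F x v q (q + \<delta>) n \<and>
      \<not> (\<exists>m. bracketed F x (w - v) (p - q - 2 * \<delta>) (p - q + 2 * \<delta>) m))"
    by measurable
  then have "?A \<in> sets borel" by (simp add: pred_def)
  ultimately show ?thesis using \<open>0 < \<epsilon>\<close> unfolding A_tilde_eps_def by blast
qed

section \<open>Differentiability tested on countably many directions\<close>

lemma has_dir_deriv_iff: "has_dir_deriv f x v d \<longleftrightarrow> (diff_quot f x v \<longlongrightarrow> d) (at 0)"
  unfolding has_dir_deriv_def diff_quot_def ..

lemma gateaux_differentiable_at_iff:
  "gateaux_differentiable_at f x \<longleftrightarrow>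
     (\<exists>L. bounded_linear L \<and> (\<forall>v. (diff_quot f x v \<longlongrightarrow> L v) (at 0)))"
proof -
  have eq: "dir_deriv f x v = d" if "(diff_quot f x v \<longlongrightarrow> d) (at 0)" for v d
    unfolding dir_deriv_def has_dir_deriv_iff
    using that by (intro the_equality) (auto intro: tendsto_unique[OF trivial_limit_at])
  show ?thesis
  proof
    assume "gateaux_differentiable_at f x"
    then have "\<forall>v. \<exists>d. (diff_quot f x v \<longlongrightarrow> d) (at 0)" "bounded_linear (dir_deriv f x)"
      unfolding gateaux_differentiable_at_def has_dir_deriv_iff by blast+
    then show "\<exists>L. bounded_linear L \<and> (\<forall>v. (diff_quot f x v \<longlongrightarrow> L v) (at 0))"
      using eq by (intro exI[of _ "dir_deriv f x"]) metis
  next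
    assume "\<exists>L. bounded_linear L \<and> (\<forall>v. (diff_quot f x v \<longlongrightarrow> L v) (at 0))"
    then obtain L where L: "bounded_linear L" "\<And>v. (diff_quot f x v \<longlongrightarrow> L v) (at 0)" by blast
    then have "dir_deriv f x = L" using eq by blast
    then show "gateaux_differentiable_at f x"
      unfolding gateaux_differentiable_at_def has_dir_deriv_iff using L by auto
  qed
qed

lemma eventually_uminus_at_0:
  assumes "\<forall>\<^sub>F s in at (0::real). P s"
  shows "\<forall>\<^sub>F s in at 0. P (- s)"
  using assms unfolding eventually_at by (auto simp: dist_real_def)

lemma filterlim_scale_at_0: "c \<noteq> 0 \<Longrightarrow> filterlim (\<lambda>s::real. c * s) (at 0) (at 0)"
  unfolding filterlim_at by (auto intro!: tendsto_eq_intros simp: eventually_at_filter)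

lemma tendsto_diff_quot_scaleR:
  assumes "(diff_quot F x u \<longlongrightarrow> l) (at 0)"
  shows "(diff_quot F x (c *\<^sub>R u) \<longlongrightarrow> c * l) (at 0)"
proof (cases "c = 0")
  case True
  then show ?thesis by (simp add: diff_quot_def[abs_def])
next
  case False
  have "((\<lambda>s. c * diff_quot F x u (c * s)) \<longlongrightarrow> c * l) (at 0)"
    by (intro tendsto_mult_left filterlim_compose[OF assms filterlim_scale_at_0] False)
  moreover have "diff_quot F x (c *\<^sub>R u) = (\<lambda>s. c * diff_quot F x u (c * s))"
    using False by (simp add: fun_eq_iff diff_quot_scaleR)
  ultimately show ?thesis by simp
qed

lemma diff_quot_mono:
  assumes F: "cone_increasing K F" and "cone K" and "u - w \<in> K"
  shows "diff_quot F x w s \<le> diff_quot F x u s"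
proof (cases "s \<ge> 0")
  case True
  then have "s *\<^sub>R (u - w) \<in> K" using assms by (simp add: cone_def)
  then have "F (x + s *\<^sub>R w) \<le> F (x + s *\<^sub>R u)"
    by (intro cone_increasingD[OF F]) (simp add: algebra_simps)
  then show ?thesis using True by (simp add: diff_quot_def divide_right_mono)
next
  case False
  then have "(- s) *\<^sub>R (u - w) \<in> K" using assms(2,3) unfolding cone_def by (meson less_imp_le neg_0_le_iff_le not_le)
  then have "F (x + s *\<^sub>R u) \<le> F (x + s *\<^sub>R w)"
    by (intro cone_increasingD[OF F]) (simp add: algebra_simps)
  then show ?thesis using False by (simp add: diff_quot_def divide_right_mono_neg)
qed

lemma limit_mono_direction:
  assumes "cone_increasing K F" "cone K" "u - w \<in> K"
    and "(diff_quot F x w \<longlongrightarrow> l) (at 0)" "(diff_quot F x u \<longlongrightarrow> l') (at 0)"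
  shows "l \<le> l'"
  using diff_quot_mono[OF assms(1-3)]
  by (intro tendsto_le[OF trivial_limit_at assms(5,4)]) auto

lemma at_0_within_Rats: "at (0::real) within \<rat> \<noteq> bot"
  unfolding trivial_limit_within islimpt_approachable
proof clarsimp
  fix e :: real assume "0 < e"
  then obtain r where "r \<in> \<rat>" "0 < r" "r < e" using Rats_dense_in_real by blast
  then show "\<exists>r\<in>\<rat>. r \<noteq> 0 \<and> \<bar>r\<bar> < e" by (intro bexI[of _ r]) auto
qed

lemma eventually_scale_at_0_within_Rats:
  assumes "\<forall>\<^sub>F r in at (0::real) within \<rat>. P r" "c \<in> \<rat>" "0 < c"
  shows "\<forall>\<^sub>F r in at 0 within \<rat>. P (c * r)"
proof -
  obtain \<eta> where "\<eta> > 0" "\<And>r. r \<in> \<rat> \<Longrightarrow> r \<noteq> 0 \<Longrightarrow> \<bar>r\<bar> < \<eta> \<Longrightarrow> P r"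
    using assms(1) unfolding eventually_at by (auto simp: dist_real_def)
  then show ?thesis using assms(2,3)
    unfolding eventually_at by (intro exI[of _ "\<eta> / c"]) (auto simp: dist_real_def abs_mult field_simps)
qed

lemma limit_if_brackets:
  fixes g :: "'i \<Rightarrow> real"
  assumes "F \<noteq> bot"
    and br: "\<And>e. 0 < e \<Longrightarrow> \<exists>a b. b - a \<le> e \<and> (\<forall>\<^sub>F s in F. a \<le> g s) \<and> (\<forall>\<^sub>F s in F. g s \<le> b)"
  shows "\<exists>l. (g \<longlongrightarrow> l) F"
proof -
  obtain A B where AB: "\<forall>\<^sub>F s in F. A \<le> g s" "\<forall>\<^sub>F s in F. g s \<le> B" using br[of 1] by auto
  show ?thesis
  proof (rule limit_if_no_crossings[OF assms(1) AB])
    fix a b :: real assume "a < b"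
    obtain a' b' where ab: "b' - a' \<le> (b - a) / 2" "\<forall>\<^sub>F s in F. a' \<le> g s" "\<forall>\<^sub>F s in F. g s \<le> b'"
      using br[of "(b - a) / 2"] \<open>a < b\<close> by auto
    show "\<not> ((\<exists>\<^sub>F s in F. g s < a) \<and> (\<exists>\<^sub>F s in F. b < g s))"
    proof (rule notI, elim conjE)
      assume f: "\<exists>\<^sub>F s in F. g s < a" "\<exists>\<^sub>F s in F. b < g s"
      obtain s where "g s < a" "a' \<le> g s"
        using frequently_ex[OF frequently_eventually_conj[OF f(1) ab(2)]] by blast
      moreover obtain s' where "b < g s'" "g s' \<le> b'"
        using frequently_ex[OF frequently_eventually_conj[OF f(2) ab(3)]] by blast
      ultimately show False using ab(1) \<open>a < b\<close> by (simp add: field_simps)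
    qed
  qed
qed

text \<open>For \<open>k\<close> tending to infinity this says that the rational quotients in the directions \<open>w\<close>, \<open>v\<close> and
  \<open>w - v\<close> converge and that the third limit is the difference of the first two. The limits are replaced
  by rational approximations to keep the condition countable.\<close>

definition countably_tested :: "('a::real_normed_vector \<Rightarrow> real) \<Rightarrow> 'a set \<Rightarrow> 'a \<Rightarrow> bool" where
  "countably_tested F S x \<longleftrightarrow> (\<forall>w\<in>S. \<forall>v\<in>S. \<forall>k::nat. \<exists>p\<in>\<rat>. \<exists>q\<in>\<rat>. \<exists>n.
     bracketed F x w p (p + 1 / (real k + 1)) n \<and> bracketed F x v q (q + 1 / (real k + 1)) n \<and>
     bracketed F x (w - v) (p - q - 2 * (1 / (real k + 1))) (p - q + 2 * (1 / (real k + 1))) n)"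

lemma countably_tested_if_gateaux:
  assumes "gateaux_differentiable_at F x"
  shows "countably_tested F S x"
  unfolding countably_tested_def
proof (intro ballI allI)
  fix w v and k :: nat
  define \<delta> where "\<delta> = 1 / (real k + 1)"
  have "\<delta> > 0" by (simp add: \<delta>_def add_nonneg_pos)
  obtain L where L: "bounded_linear L" "\<And>v. (diff_quot F x v \<longlongrightarrow> L v) (at 0)"
    using assms unfolding gateaux_differentiable_at_iff by blast
  have ex: "\<exists>n. bracketed F x u a b n" if "a < L u" "L u < b" for u a b
  proof -
    have "(diff_quot F x u \<longlongrightarrow> L u) (at 0 within \<rat>)"
      using L(2) tendsto_within_subset subset_UNIV by blast
    then have "\<forall>\<^sub>F r in at 0 within \<rat>. a < diff_quot F x u r" "\<forall>\<^sub>F r in at 0 within \<rat>. diff_quot F x u r < b"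
      using that by (auto dest: order_tendstoD)
    then show ?thesis unfolding ex_bracketed_iff by eventually_elim auto
  qed
  obtain p where p: "p \<in> \<rat>" "L w - \<delta> < p" "p < L w"
    using Rats_dense_in_real[of "L w - \<delta>" "L w"] \<open>\<delta> > 0\<close> by auto
  obtain q where q: "q \<in> \<rat>" "L v - \<delta> < q" "q < L v"
    using Rats_dense_in_real[of "L v - \<delta>" "L v"] \<open>\<delta> > 0\<close> by auto
  have "L (w - v) = L w - L v" using L(1) by (simp add: bounded_linear.linear linear_diff)
  then have "\<exists>n. bracketed F x (w - v) (p - q - 2 * \<delta>) (p - q + 2 * \<delta>) n"
    using p q \<open>\<delta> > 0\<close> by (intro ex) auto
  moreover have "\<exists>n. bracketed F x w p (p + \<delta>) n" "\<exists>n. bracketed F x v q (q + \<delta>) n"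
    using p q by (auto intro!: ex)
  ultimately obtain n1 n2 n3 where n: "bracketed F x (w - v) (p - q - 2 * \<delta>) (p - q + 2 * \<delta>) n1"
    "bracketed F x w p (p + \<delta>) n2" "bracketed F x v q (q + \<delta>) n3" by blast
  let ?n = "max n1 (max n2 n3)"
  have "bracketed F x w p (p + \<delta>) ?n \<and> bracketed F x v q (q + \<delta>) ?n \<and>
     bracketed F x (w - v) (p - q - 2 * \<delta>) (p - q + 2 * \<delta>) ?n"
    using n by (auto elim!: bracketed_antimono)
  then show "\<exists>p\<in>\<rat>. \<exists>q\<in>\<rat>. \<exists>n.
     bracketed F x w p (p + 1 / (real k + 1)) n \<and> bracketed F x v q (q + 1 / (real k + 1)) n \<and>
     bracketed F x (w - v) (p - q - 2 * (1 / (real k + 1))) (p - q + 2 * (1 / (real k + 1))) n"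
    unfolding \<delta>_def[symmetric] using p(1) q(1) by blast
qed

text \<open>Density serves to place an element of \<open>S\<close> strictly between two multiples of an interior vector.\<close>

locale dense_directions =
  fixes K :: "'a::real_normed_vector set" and F :: "'a \<Rightarrow> real" and S :: "'a set"
  assumes convex: "convex K" and cone: "cone K" and solid: "interior K \<noteq> {}"
    and increasing: "cone_increasing K F"
    and S_interior: "S \<subseteq> interior K"
    and S_dense: "\<And>U. open U \<Longrightarrow> U \<inter> interior K \<noteq> {} \<Longrightarrow> U \<inter> S \<noteq> {}"
begin

lemma add_interior: "a \<in> interior K \<Longrightarrow> b \<in> interior K \<Longrightarrow> a + b \<in> interior K"
  using interior_cone_add[OF convex cone] interior_subset by blast

lemma direction_between:
  assumes "b - a \<in> interior K" "(1/2) *\<^sub>R (a + b) \<in> interior K"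
  obtains u where "u \<in> S" "u - a \<in> interior K" "b - u \<in> interior K"
proof -
  let ?U = "(\<lambda>u. u - a) -` interior K \<inter> (\<lambda>u. b - u) -` interior K"
  have "open ?U" by (intro open_Int open_vimage open_interior continuous_intros)
  moreover have "(1/2) *\<^sub>R (a + b) - a = (1/2) *\<^sub>R (b - a)" "b - (1/2) *\<^sub>R (a + b) = (1/2) *\<^sub>R (b - a)"
    by (simp_all add: algebra_simps flip: scaleR_add_left)
  then have "(1/2) *\<^sub>R (a + b) \<in> ?U"
    using interior_cone_scaleR[OF cone assms(1), of "1/2"] by simp
  ultimately have "?U \<inter> S \<noteq> {}" using assms(2) by (intro S_dense) blast+
  then show thesis using that by blast
qed

lemma direction_between_multiples:
  assumes "w \<in> interior K" "0 < a" "a < b"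
  obtains u where "u \<in> S" "u - a *\<^sub>R w \<in> interior K" "b *\<^sub>R w - u \<in> interior K"
proof (rule direction_between[of "b *\<^sub>R w" "a *\<^sub>R w"])
  have "(b - a) *\<^sub>R w \<in> interior K" "((a + b) / 2) *\<^sub>R w \<in> interior K"
    using assms by (auto intro!: interior_cone_scaleR[OF cone])
  then show "b *\<^sub>R w - a *\<^sub>R w \<in> interior K" "(1/2) *\<^sub>R (a *\<^sub>R w + b *\<^sub>R w) \<in> interior K"
    by (simp_all add: algebra_simps add_divide_distrib)
qed (rule that)

lemma tested_brackets:
  assumes "countably_tested F S x" "w \<in> S" "v \<in> S" "0 < e"
  obtains p q \<delta> where "0 < \<delta>" "\<delta> \<le> e"
    "\<forall>\<^sub>F r in at 0 within \<rat>. p \<le> diff_quot F x w r \<and> diff_quot F x w r \<le> p + \<delta>"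
    "\<forall>\<^sub>F r in at 0 within \<rat>. q \<le> diff_quot F x v r \<and> diff_quot F x v r \<le> q + \<delta>"
    "\<forall>\<^sub>F r in at 0 within \<rat>. diff_quot F x (w - v) r \<le> p - q + 2 * \<delta>"
proof -
  obtain k where k: "inverse (real (Suc k)) < e" using reals_Archimedean[OF assms(4)] by blast
  define \<delta> where "\<delta> = 1 / (real k + 1)"
  have \<delta>: "0 < \<delta>" "\<delta> \<le> e" using k by (auto simp: \<delta>_def add_nonneg_pos inverse_eq_divide add.commute)
  obtain p q n where "bracketed F x w p (p + \<delta>) n" "bracketed F x v q (q + \<delta>) n"
     "bracketed F x (w - v) (p - q - 2 * \<delta>) (p - q + 2 * \<delta>) n"
    using assms(1-3) unfolding countably_tested_def \<delta>_def by blast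
  then have "\<forall>\<^sub>F r in at 0 within \<rat>. p \<le> diff_quot F x w r \<and> diff_quot F x w r \<le> p + \<delta>"
    "\<forall>\<^sub>F r in at 0 within \<rat>. q \<le> diff_quot F x v r \<and> diff_quot F x v r \<le> q + \<delta>"
    "\<forall>\<^sub>F r in at 0 within \<rat>. p - q - 2 * \<delta> \<le> diff_quot F x (w - v) r \<and> diff_quot F x (w - v) r \<le> p - q + 2 * \<delta>"
    unfolding ex_bracketed_iff[symmetric] by blast+
  then show thesis using that[OF \<delta>] by (simp add: eventually_conj_iff)
qed

text \<open>If \<open>u\<close> is an element of \<open>S\<close> slightly below \<open>w\<close>, then \<open>w\<close> lies between \<open>u\<close> and \<open>(1 + \<kappa>) u\<close>, and the
  quotients in direction \<open>(1 + \<kappa>) u\<close> are multiples of quotients in direction \<open>u\<close>. The bound \<open>M\<close>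
  makes the relative error \<open>\<kappa>\<close> absolute.\<close>

lemma interior_limit_exists:
  assumes tested: "countably_tested F S x" and w: "w \<in> interior K"
  shows "\<exists>l. (diff_quot F x w \<longlongrightarrow> l) (at 0)"
proof -
  have "\<exists>M. \<forall>\<^sub>F s in at 0. diff_quot F x w s \<le> M"
  proof -
    obtain u where u: "u \<in> S" "u - 1 *\<^sub>R w \<in> interior K"
      using direction_between_multiples[OF w, of 1 2] by auto
    obtain p \<delta> :: real where "\<forall>\<^sub>F r in at 0 within \<rat>. p \<le> diff_quot F x u r \<and> diff_quot F x u r \<le> p + \<delta>"
      by (rule tested_brackets[OF tested u(1) u(1) zero_less_one]) blast
    then have "\<forall>\<^sub>F s in at 0. diff_quot F x w s \<le> p + \<delta>"
      using u(2) by (intro eventually_diff_quot_le[OF increasing cone, of u]) (auto simp: eventually_conj_iff)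
    then show ?thesis ..
  qed
  then obtain M where M: "\<forall>\<^sub>F s in at 0. diff_quot F x w s \<le> M" ..
  show ?thesis
  proof (rule limit_if_brackets[OF trivial_limit_at])
    fix e :: real assume "0 < e"
    then have "0 < min 1 (e / (2 * (\<bar>M\<bar> + 1)))" by (simp add: add_nonneg_pos)
    then obtain \<kappa> where \<kappa>: "\<kappa> \<in> \<rat>" "0 < \<kappa>" "\<kappa> < min 1 (e / (2 * (\<bar>M\<bar> + 1)))"
      using Rats_dense_in_real by blast
    have \<kappa>e: "\<kappa> * (2 * (\<bar>M\<bar> + 1)) < e" "\<kappa> < 1"
      using \<kappa>(3) by (auto simp: pos_less_divide_eq add_nonneg_pos)
    obtain u where u: "u \<in> S" "u - (1 / (1 + \<kappa>)) *\<^sub>R w \<in> interior K" "1 *\<^sub>R w - u \<in> interior K"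
      using direction_between_multiples[OF w, of "1 / (1 + \<kappa>)" 1] \<kappa>(2) by auto
    have "(1 + \<kappa>) *\<^sub>R (u - (1 / (1 + \<kappa>)) *\<^sub>R w) \<in> interior K"
      using \<kappa>(2) by (intro interior_cone_scaleR[OF cone u(2)]) auto
    then have u': "(1 + \<kappa>) *\<^sub>R u - w \<in> interior K" using \<kappa>(2) by (simp add: scaleR_diff_right)
    have e4: "0 < e / 4" using \<open>0 < e\<close> by simp
    obtain p \<delta> where \<delta>: "0 < \<delta>" "\<delta> \<le> e / 4"
      and p: "\<forall>\<^sub>F r in at 0 within \<rat>. p \<le> diff_quot F x u r \<and> diff_quot F x u r \<le> p + \<delta>"
      by (rule tested_brackets[OF tested u(1) u(1) e4]) blast
    have lower: "\<forall>\<^sub>F s in at 0. p \<le> diff_quot F x w s"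
      using p u(3) by (intro eventually_diff_quot_ge[OF increasing cone, of _ u]) (auto simp: eventually_conj_iff)
    have "\<forall>\<^sub>F r in at 0 within \<rat>. p \<le> diff_quot F x u ((1 + \<kappa>) * r) \<and> diff_quot F x u ((1 + \<kappa>) * r) \<le> p + \<delta>"
      using \<kappa> by (intro eventually_scale_at_0_within_Rats[OF p]) auto
    then have "\<forall>\<^sub>F r in at 0 within \<rat>. diff_quot F x ((1 + \<kappa>) *\<^sub>R u) r \<le> (1 + \<kappa>) * (p + \<delta>)"
      by eventually_elim (use \<kappa>(2) in \<open>auto simp: diff_quot_scaleR\<close>)
    then have upper: "\<forall>\<^sub>F s in at 0. diff_quot F x w s \<le> (1 + \<kappa>) * (p + \<delta>)"
      by (rule eventually_diff_quot_le[OF increasing cone u'])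
    have "\<forall>\<^sub>F s in at (0::real). p \<le> M" using lower M by eventually_elim auto
    then have "p \<le> M" by simp
    then have "\<kappa> * p \<le> \<kappa> * (\<bar>M\<bar> + 1)" using \<kappa>(2) by (intro mult_left_mono) auto
    moreover have "\<kappa> * \<delta> \<le> 1 * \<delta>" using \<kappa>e(2) \<delta>(1) by (intro mult_right_mono) auto
    ultimately have "(1 + \<kappa>) * (p + \<delta>) - p \<le> e"
      using \<kappa>e(1) \<delta>(2) by (simp add: algebra_simps)
    then show "\<exists>a b. b - a \<le> e \<and> (\<forall>\<^sub>F s in at 0. a \<le> diff_quot F x w s) \<and> (\<forall>\<^sub>F s in at 0. diff_quot F x w s \<le> b)"
      using lower upper by blast
  qed
qed

text \<open>Enlarging \<open>w\<close> to \<open>w'\<close> and reducing \<open>v\<close> to \<open>v'\<close> increases \<open>w - v\<close>, so the tested bound for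
  \<open>w' - v'\<close> transfers. By monotonicity and homogeneity the limits at \<open>w'\<close> and \<open>v'\<close> differ from
  those at \<open>w\<close> and \<open>v\<close> by at most a factor of \<open>1 + \<kappa>\<close> and \<open>1 - \<kappa>\<close>.\<close>

lemma difference_upper_bound:
  assumes tested: "countably_tested F S x" and w: "w \<in> interior K" and v: "v \<in> interior K"
    and lw: "(diff_quot F x w \<longlongrightarrow> lw) (at 0)" and lv: "(diff_quot F x v \<longlongrightarrow> lv) (at 0)" and "0 < e"
  shows "\<forall>\<^sub>F s in at 0. diff_quot F x (w - v) s \<le> lw - lv + e"
proof -
  define \<kappa> where "\<kappa> = min (1/2) (e / (2 * (\<bar>lw\<bar> + \<bar>lv\<bar> + 1)))"
  have \<kappa>: "0 < \<kappa>" "\<kappa> < 1" using \<open>0 < e\<close> by (auto simp: \<kappa>_def add_nonneg_pos min_def)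
  have "\<kappa> * (2 * (\<bar>lw\<bar> + \<bar>lv\<bar> + 1)) \<le> e / (2 * (\<bar>lw\<bar> + \<bar>lv\<bar> + 1)) * (2 * (\<bar>lw\<bar> + \<bar>lv\<bar> + 1))"
    by (intro mult_right_mono) (auto simp: \<kappa>_def)
  then have \<kappa>e: "\<kappa> * (2 * (\<bar>lw\<bar> + \<bar>lv\<bar> + 1)) \<le> e" by (simp add: add_nonneg_eq_0_iff)
  obtain w' where w': "w' \<in> S" "w' - 1 *\<^sub>R w \<in> interior K" "(1 + \<kappa>) *\<^sub>R w - w' \<in> interior K"
    using direction_between_multiples[OF w, of 1 "1 + \<kappa>"] \<kappa> by auto
  obtain v' where v': "v' \<in> S" "v' - (1 - \<kappa>) *\<^sub>R v \<in> interior K" "1 *\<^sub>R v - v' \<in> interior K"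
    using direction_between_multiples[OF v, of "1 - \<kappa>" 1] \<kappa> by auto
  have e6: "0 < e / 6" using \<open>0 < e\<close> by simp
  obtain p q \<delta> where \<delta>: "0 < \<delta>" "\<delta> \<le> e / 6"
    and p: "\<forall>\<^sub>F r in at 0 within \<rat>. p \<le> diff_quot F x w' r \<and> diff_quot F x w' r \<le> p + \<delta>"
    and q: "\<forall>\<^sub>F r in at 0 within \<rat>. q \<le> diff_quot F x v' r \<and> diff_quot F x v' r \<le> q + \<delta>"
    and pq: "\<forall>\<^sub>F r in at 0 within \<rat>. diff_quot F x (w' - v') r \<le> p - q + 2 * \<delta>"
    by (rule tested_brackets[OF tested w'(1) v'(1) e6]) blast
  obtain lw' where lw': "(diff_quot F x w' \<longlongrightarrow> lw') (at 0)"
    using interior_limit_exists[OF tested] w'(1) S_interior by blast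
  obtain lv' where lv': "(diff_quot F x v' \<longlongrightarrow> lv') (at 0)"
    using interior_limit_exists[OF tested] v'(1) S_interior by blast
  have "p \<le> lw'"
    using p by (intro tendsto_lowerbound[OF tendsto_within_subset[OF lw' subset_UNIV] _ at_0_within_Rats])
      (auto simp: eventually_conj_iff)
  moreover have "lw' \<le> (1 + \<kappa>) * lw"
    using w'(3) interior_subset by (intro limit_mono_direction[OF increasing cone _ lw' tendsto_diff_quot_scaleR[OF lw]]) blast
  moreover have "lv' \<le> q + \<delta>"
    using q by (intro tendsto_upperbound[OF tendsto_within_subset[OF lv' subset_UNIV] _ at_0_within_Rats])
      (auto simp: eventually_conj_iff)
  moreover have "(1 - \<kappa>) * lv \<le> lv'"
    using v'(2) interior_subset by (intro limit_mono_direction[OF increasing cone _ tendsto_diff_quot_scaleR[OF lv] lv']) blast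
  moreover have "\<kappa> * (lw + lv) \<le> \<kappa> * (\<bar>lw\<bar> + \<bar>lv\<bar> + 1)" using \<kappa> by (intro mult_left_mono) auto
  ultimately have "p - q + 2 * \<delta> \<le> lw - lv + e"
    using \<kappa>e \<delta>(2) by (simp add: algebra_simps)
  moreover have "(w' - w) + (v - v') \<in> interior K" using w'(2) v'(3) by (intro add_interior) auto
  then have "(w' - v') - (w - v) \<in> interior K" by (simp add: algebra_simps)
  then have "\<forall>\<^sub>F s in at 0. diff_quot F x (w - v) s \<le> p - q + 2 * \<delta>"
    by (rule eventually_diff_quot_le[OF increasing cone _ pq])
  ultimately show ?thesis by (auto elim: eventually_mono)
qed

lemma difference_limit:
  assumes tested: "countably_tested F S x" and w: "w \<in> interior K" and v: "v \<in> interior K"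
    and lw: "(diff_quot F x w \<longlongrightarrow> lw) (at 0)" and lv: "(diff_quot F x v \<longlongrightarrow> lv) (at 0)"
  shows "(diff_quot F x (w - v) \<longlongrightarrow> lw - lv) (at 0)"
proof (rule tendstoI)
  fix e :: real assume "0 < e"
  have upper: "\<forall>\<^sub>F s in at 0. diff_quot F x (w - v) s \<le> lw - lv + e / 2"
    using \<open>0 < e\<close> by (intro difference_upper_bound[OF tested w v lw lv]) auto
  have "\<forall>\<^sub>F s in at 0. diff_quot F x (v - w) (- s) \<le> lv - lw + e / 2"
    using \<open>0 < e\<close> by (intro eventually_uminus_at_0 difference_upper_bound[OF tested v w lv lw]) auto
  moreover have "diff_quot F x (v - w) (- s) = - diff_quot F x (w - v) s" for s
    using diff_quot_uminus[of F x "w - v" "- s"] by simp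
  ultimately have "\<forall>\<^sub>F s in at 0. - diff_quot F x (w - v) s \<le> lv - lw + e / 2" by simp
  with upper show "\<forall>\<^sub>F s in at 0. dist (diff_quot F x (w - v) s) (lw - lv) < e"
    by eventually_elim (use \<open>0 < e\<close> in \<open>auto simp: dist_real_def abs_less_iff field_simps\<close>)
qed

text \<open>Every vector is a difference of interior ones, so all directional derivatives exist. Writing
  \<open>a = (a + b) - b\<close> shows that they are additive on the interior, hence everywhere. They are bounded
  because \<open>z \<le> (norm z / c) v0\<close> in the order of \<open>K\<close>.\<close>

theorem gateaux_if_countably_tested:
  assumes tested: "countably_tested F S x"
  shows "gateaux_differentiable_at F x"
proof -
  obtain v0 where v0: "v0 \<in> interior K" using solid by blast
  obtain c where c: "0 < c" "\<And>s y. 0 \<le> s \<Longrightarrow> norm y \<le> c * s \<Longrightarrow> s *\<^sub>R v0 + y \<in> K"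
    using interior_cone_cushion[OF cone v0] by blast
  have "\<forall>w\<in>interior K. \<exists>l. (diff_quot F x w \<longlongrightarrow> l) (at 0)" using interior_limit_exists[OF tested] by blast
  then obtain lim where lim: "\<And>w. w \<in> interior K \<Longrightarrow> (diff_quot F x w \<longlongrightarrow> lim w) (at 0)" by metis
  have split: "\<exists>a b. a \<in> interior K \<and> b \<in> interior K \<and> z = a - b" for z
  proof -
    let ?s = "norm z / c"
    have "?s *\<^sub>R v0 + z \<in> K" using c by (intro c(2)) auto
    then have "v0 + (?s *\<^sub>R v0 + z) \<in> interior K" by (rule interior_cone_add[OF convex cone v0])
    moreover have "(1 + ?s) *\<^sub>R v0 \<in> interior K"
      using c(1) by (intro interior_cone_scaleR[OF cone v0]) (simp add: add_pos_nonneg)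
    moreover have "z = (v0 + (?s *\<^sub>R v0 + z)) - (1 + ?s) *\<^sub>R v0" by (simp add: algebra_simps)
    ultimately show ?thesis by blast
  qed
  define L where "L z = Lim (at 0) (diff_quot F x z)" for z
  have Lim: "L z = l" if "(diff_quot F x z \<longlongrightarrow> l) (at 0)" for z l
    unfolding L_def using that by (intro tendsto_Lim) auto
  have diff: "(diff_quot F x (a - b) \<longlongrightarrow> lim a - lim b) (at 0)" if "a \<in> interior K" "b \<in> interior K" for a b
    using difference_limit[OF tested that] lim that by blast
  have L: "(diff_quot F x z \<longlongrightarrow> L z) (at 0)" for z
  proof -
    obtain a b where "a \<in> interior K" "b \<in> interior K" "z = a - b" using split by blast
    then have "(diff_quot F x z \<longlongrightarrow> lim a - lim b) (at 0)" using diff by blast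
    then show ?thesis using Lim by simp
  qed
  have lim_add: "lim (a + b) = lim a + lim b" if "a \<in> interior K" "b \<in> interior K" for a b
  proof -
    have "(diff_quot F x ((a + b) - b) \<longlongrightarrow> lim (a + b) - lim b) (at 0)"
      using that by (intro diff add_interior)
    then have "lim (a + b) - lim b = lim a" using tendsto_unique[OF trivial_limit_at _ lim[OF that(1)]] by simp
    then show ?thesis by simp
  qed
  have add: "L (y + z) = L y + L z" for y z
  proof -
    obtain a b a' b' where ab: "a \<in> interior K" "b \<in> interior K" "y = a - b"
      "a' \<in> interior K" "b' \<in> interior K" "z = a' - b'" using split by metis
    have "(diff_quot F x ((a + a') - (b + b')) \<longlongrightarrow> lim (a + a') - lim (b + b')) (at 0)"
      using ab by (intro diff add_interior)
    then have "L ((a + a') - (b + b')) = lim (a + a') - lim (b + b')" by (rule Lim)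
    moreover have "(a + a') - (b + b') = y + z" using ab by simp
    moreover have "L y = lim a - lim b" "L z = lim a' - lim b'" using ab by (auto intro!: Lim diff)
    ultimately show ?thesis using ab lim_add by simp
  qed
  have scale: "L (r *\<^sub>R z) = r * L z" for r z
    by (rule Lim[OF tendsto_diff_quot_scaleR[OF L]])
  have le: "L z \<le> norm z * (L v0 / c)" for z
  proof -
    have "(norm z / c) *\<^sub>R v0 + - z \<in> K" using c by (intro c(2)) auto
    then have "L z \<le> L ((norm z / c) *\<^sub>R v0)"
      by (intro limit_mono_direction[OF increasing cone _ L L]) simp
    then show ?thesis by (simp add: scale)
  qed
  have "bounded_linear L"
  proof (rule bounded_linear_intro[where K = "L v0 / c"])
    show "L (y + z) = L y + L z" for y z by (rule add)
    show "L (r *\<^sub>R z) = r *\<^sub>R L z" for r z by (simp add: scale)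
    show "norm (L z) \<le> norm z * (L v0 / c)" for z
      using le[of z] le[of "- z"] scale[of "- 1" z] by (simp add: abs_le_iff)
  qed
  then show ?thesis unfolding gateaux_differentiable_at_iff using L by blast
qed

end

section \<open>Replacing the function by a Borel one\<close>

text \<open>Differentiability of \<open>F\<close> along \<open>v\<close> forces \<open>G x = F x\<close>. Taking \<open>\<delta> = \<epsilon> \<bar>s\<bar>\<close> in the sandwich then bounds
  the quotients of \<open>G\<close> in direction \<open>u\<close> by those of \<open>F\<close> in the directions \<open>u - \<epsilon> v\<close> and \<open>u + \<epsilon> v\<close>, whose
  limits differ by \<open>2 \<epsilon> L v\<close>.\<close>

lemma gateaux_transfer:
  fixes F G :: "'a::real_normed_vector \<Rightarrow> real"
  assumes sandwich: "\<And>y \<delta>. 0 < \<delta> \<Longrightarrow> F (y - \<delta> *\<^sub>R v) \<le> G y \<and> G y \<le> F (y + \<delta> *\<^sub>R v)"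
    and "gateaux_differentiable_at F x"
  shows "gateaux_differentiable_at G x"
proof -
  obtain L where L: "bounded_linear L" "\<And>u. (diff_quot F x u \<longlongrightarrow> L u) (at 0)"
    using assms(2) unfolding gateaux_differentiable_at_iff by blast
  have "((\<lambda>s. F x + diff_quot F x v s * s) \<longlongrightarrow> F x + L v * 0) (at 0)"
    by (intro tendsto_intros L)
  moreover have "\<forall>\<^sub>F s in at 0. F x + diff_quot F x v s * s = F (x + s *\<^sub>R v)"
    by (auto simp: eventually_at_filter diff_quot_def)
  ultimately have "((\<lambda>s. F (x + s *\<^sub>R v)) \<longlongrightarrow> F x) (at 0)"
    by (simp add: Lim_transform_eventually)
  then have cont: "((\<lambda>s. F (x + s *\<^sub>R v)) \<longlongrightarrow> F x) (at_right 0)" "((\<lambda>s. F (x + s *\<^sub>R v)) \<longlongrightarrow> F x) (at_left 0)"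
    using filterlim_at_split by blast+
  have "G x = F x"
  proof (rule antisym)
    show "G x \<le> F x"
      using sandwich by (intro tendsto_lowerbound[OF cont(1)]) (auto simp: eventually_at_filter)
    have "F (x + s *\<^sub>R v) \<le> G x" if "s < 0" for s
      using sandwich[of "- s" x] that by simp
    then show "F x \<le> G x"
      by (intro tendsto_upperbound[OF cont(2)]) (auto simp: eventually_at_filter)
  qed
  have between: "diff_quot F x (u - \<epsilon> *\<^sub>R v) s \<le> diff_quot G x u s \<and> diff_quot G x u s \<le> diff_quot F x (u + \<epsilon> *\<^sub>R v) s"
    if "0 < \<epsilon>" for u \<epsilon> s
  proof (cases "s = 0")
    case False
    have "F (x + s *\<^sub>R u - (\<bar>s\<bar> * \<epsilon>) *\<^sub>R v) \<le> G (x + s *\<^sub>R u)" "G (x + s *\<^sub>R u) \<le> F (x + s *\<^sub>R u + (\<bar>s\<bar> * \<epsilon>) *\<^sub>R v)"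
      using sandwich[of "\<bar>s\<bar> * \<epsilon>" "x + s *\<^sub>R u"] False that by auto
    note sandwich_s = this
    show ?thesis
    proof (cases "s > 0")
      case True
      then have eq: "x + s *\<^sub>R (u - \<epsilon> *\<^sub>R v) = x + s *\<^sub>R u - (\<bar>s\<bar> * \<epsilon>) *\<^sub>R v"
        "x + s *\<^sub>R (u + \<epsilon> *\<^sub>R v) = x + s *\<^sub>R u + (\<bar>s\<bar> * \<epsilon>) *\<^sub>R v" by (simp_all add: algebra_simps)
      show ?thesis
        unfolding diff_quot_def eq \<open>G x = F x\<close>
        using sandwich_s True by (intro conjI divide_right_mono) simp_all
    next
      case s: False
      then have eq: "x + s *\<^sub>R (u - \<epsilon> *\<^sub>R v) = x + s *\<^sub>R u + (\<bar>s\<bar> * \<epsilon>) *\<^sub>R v"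
        "x + s *\<^sub>R (u + \<epsilon> *\<^sub>R v) = x + s *\<^sub>R u - (\<bar>s\<bar> * \<epsilon>) *\<^sub>R v" by (simp_all add: algebra_simps)
      show ?thesis
        unfolding diff_quot_def eq \<open>G x = F x\<close>
        using sandwich_s s by (intro conjI divide_right_mono_neg) simp_all
    qed
  qed (simp add: diff_quot_def)
  have "(diff_quot G x u \<longlongrightarrow> L u) (at 0)" for u
  proof (rule tendstoI)
    fix e :: real assume "0 < e"
    define \<epsilon> where "\<epsilon> = e / (2 * (\<bar>L v\<bar> + 1))"
    have "0 < \<epsilon>" using \<open>0 < e\<close> by (simp add: \<epsilon>_def add_nonneg_pos)
    have "2 * \<bar>L v\<bar> + 2 \<noteq> 0" by linarith
    then have "\<epsilon> * (\<bar>L v\<bar> + 1) = e / 2" by (simp add: \<epsilon>_def field_simps)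
    then have \<epsilon>L: "\<bar>\<epsilon> * L v\<bar> \<le> e / 2" using \<open>0 < \<epsilon>\<close> by (simp add: abs_mult algebra_simps)
    have lin: "L (u + \<epsilon> *\<^sub>R v) = L u + \<epsilon> * L v" "L (u - \<epsilon> *\<^sub>R v) = L u - \<epsilon> * L v"
      using L(1) by (simp_all add: bounded_linear.linear linear_add linear_diff linear_scale)
    have "\<forall>\<^sub>F s in at 0. dist (diff_quot F x (u + \<epsilon> *\<^sub>R v) s) (L u + \<epsilon> * L v) < e / 2"
      using tendstoD[OF L(2)[of "u + \<epsilon> *\<^sub>R v"], of "e / 2"] \<open>0 < e\<close> by (simp add: lin)
    moreover have "\<forall>\<^sub>F s in at 0. dist (diff_quot F x (u - \<epsilon> *\<^sub>R v) s) (L u - \<epsilon> * L v) < e / 2"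
      using tendstoD[OF L(2)[of "u - \<epsilon> *\<^sub>R v"], of "e / 2"] \<open>0 < e\<close> by (simp add: lin)
    ultimately show "\<forall>\<^sub>F s in at 0. dist (diff_quot G x u s) (L u) < e"
    proof eventually_elim
      case (elim s)
      then show ?case using between[OF \<open>0 < \<epsilon>\<close>, of u s] \<epsilon>L unfolding dist_real_def by linarith
    qed
  qed
  then show ?thesis unfolding gateaux_differentiable_at_iff using L(1) by blast
qed

text \<open>For an increasing \<open>f\<close> and \<open>v\<close> interior to the cone this is the lower semicontinuous regularisation
  of \<open>f\<close>; being a supremum along a single sequence, it is easy to handle.\<close>

definition lower_envelope :: "'a::real_normed_vector \<Rightarrow> ('a \<Rightarrow> real) \<Rightarrow> 'a \<Rightarrow> real" where
  "lower_envelope v f x = (SUP n. f (x - (1 / (real n + 1)) *\<^sub>R v))"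

context
  fixes K :: "'a::real_normed_vector set" and f :: "'a \<Rightarrow> real" and v :: 'a
  assumes cone: "cone K" and f: "cone_increasing K f" and v: "v \<in> interior K"
begin

lemma cone_increasing_step_down: "0 \<le> \<delta> \<Longrightarrow> f (x - \<delta> *\<^sub>R v) \<le> f x"
  using cone v interior_subset[of K] by (intro cone_increasingD[OF f]) (auto simp: cone_def)

lemma lower_envelope_upper: "f (x - (1 / (real n + 1)) *\<^sub>R v) \<le> lower_envelope v f x"
  unfolding lower_envelope_def
  by (intro cSUP_upper bdd_aboveI[of _ "f x"]) (auto intro: cone_increasing_step_down)

lemma lower_envelope_le: "lower_envelope v f x \<le> f x"
  unfolding lower_envelope_def by (intro cSUP_least) (auto intro: cone_increasing_step_down)

lemma le_lower_envelope: "0 < \<delta> \<Longrightarrow> f (x - \<delta> *\<^sub>R v) \<le> lower_envelope v f x"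
proof -
  assume "0 < \<delta>"
  then obtain n where "inverse (real (Suc n)) < \<delta>" using reals_Archimedean by blast
  then have "0 \<le> \<delta> - 1 / (real n + 1)" by (simp add: inverse_eq_divide add.commute)
  from cone_increasing_step_down[OF this, of "x - (1 / (real n + 1)) *\<^sub>R v"]
  have "f (x - \<delta> *\<^sub>R v) \<le> f (x - (1 / (real n + 1)) *\<^sub>R v)" by (simp add: algebra_simps)
  then show ?thesis using lower_envelope_upper order_trans by blast
qed

lemma cone_increasing_lower_envelope: "cone_increasing K (lower_envelope v f)"
  unfolding cone_increasing_def cone_le_def
proof (intro allI impI)
  fix x y assume xy: "y - x \<in> K"
  have "f (x - \<delta> *\<^sub>R v) \<le> f (y - \<delta> *\<^sub>R v)" for \<delta>
    using xy by (intro cone_increasingD[OF f]) simp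
  then show "lower_envelope v f x \<le> lower_envelope v f y"
    unfolding lower_envelope_def[of v f x] using lower_envelope_upper[of y]
    by (intro cSUP_least) (auto intro: order_trans)
qed

text \<open>If \<open>f (x - v / (n + 1)) > a\<close>, then the next, shorter step down from any \<open>y\<close> close to \<open>x\<close> still ends
  above \<open>x - v / (n + 1)\<close>. So the envelope is lower semicontinuous.\<close>

lemma borel_lower_envelope: "lower_envelope v f \<in> borel_measurable borel"
proof (rule borel_measurableI_greater)
  fix a
  have "open {x. a < lower_envelope v f x}"
    unfolding open_dist
  proof (intro ballI)
    fix x assume "x \<in> {x. a < lower_envelope v f x}"
    then obtain n where n: "a < f (x - (1 / (real n + 1)) *\<^sub>R v)"
      unfolding lower_envelope_def
      by (subst (asm) mem_Collect_eq, subst (asm) less_cSUP_iff) (auto intro!: bdd_aboveI[of _ "f x"] cone_increasing_step_down)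
    define s where "s = 1 / (real n + 1) - 1 / (real (Suc n) + 1)"
    have "0 < s" by (simp add: s_def divide_strict_left_mono)
    obtain c where c: "0 < c" "\<And>s y. 0 \<le> s \<Longrightarrow> norm y \<le> c * s \<Longrightarrow> s *\<^sub>R v + y \<in> K"
      using interior_cone_cushion[OF cone v] by blast
    have "a < lower_envelope v f y" if "dist y x < c * s" for y
    proof -
      have "s *\<^sub>R v + (y - x) \<in> K" using that \<open>0 < s\<close> by (intro c(2)) (auto simp: dist_norm)
      then have "f (x - (1 / (real n + 1)) *\<^sub>R v) \<le> f (y - (1 / (real (Suc n) + 1)) *\<^sub>R v)"
        by (intro cone_increasingD[OF f]) (simp add: s_def algebra_simps)
      also have "\<dots> \<le> lower_envelope v f y" by (rule lower_envelope_upper)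
      finally show ?thesis using n by linarith
    qed
    then show "\<exists>e>0. \<forall>y. dist y x < e \<longrightarrow> y \<in> {x. a < lower_envelope v f x}"
      using c(1) \<open>0 < s\<close> by (intro exI[of _ "c * s"]) auto
  qed
  then show "{x \<in> space borel. a < lower_envelope v f x} \<in> sets borel" by simp
qed

lemma gateaux_lower_envelope_iff:
  "gateaux_differentiable_at (lower_envelope v f) x \<longleftrightarrow> gateaux_differentiable_at f x"
proof
  have up: "f y \<le> lower_envelope v f (y + \<delta> *\<^sub>R v)" if "0 < \<delta>" for y \<delta>
    using le_lower_envelope[OF that, of "y + \<delta> *\<^sub>R v"] by simp
  have down: "f y \<le> f (y + \<delta> *\<^sub>R v)" if "0 < \<delta>" for y \<delta>
    using cone_increasing_step_down[of \<delta> "y + \<delta> *\<^sub>R v"] that by simp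
  show "gateaux_differentiable_at f x" if "gateaux_differentiable_at (lower_envelope v f) x"
    using that
  proof (rule gateaux_transfer[rotated])
    fix y and \<delta> :: real assume "0 < \<delta>"
    then show "lower_envelope v f (y - \<delta> *\<^sub>R v) \<le> f y \<and> f y \<le> lower_envelope v f (y + \<delta> *\<^sub>R v)"
      using lower_envelope_le[of "y - \<delta> *\<^sub>R v"] cone_increasing_step_down[of \<delta> y] up by force
  qed
  show "gateaux_differentiable_at (lower_envelope v f) x" if "gateaux_differentiable_at f x"
    using that
  proof (rule gateaux_transfer[rotated])
    fix y and \<delta> :: real assume "0 < \<delta>"
    then show "f (y - \<delta> *\<^sub>R v) \<le> lower_envelope v f y \<and> lower_envelope v f y \<le> f (y + \<delta> *\<^sub>R v)"
      using le_lower_envelope lower_envelope_le[of y] down[of \<delta> y] by force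
  qed
qed

end

section \<open>The exceptional set\<close>

lemma borel_countably_tested:
  fixes F :: "'a::real_normed_vector \<Rightarrow> real"
  assumes F_borel [measurable]: "F \<in> borel_measurable borel" and "countable S"
  shows "{x. countably_tested F S x} \<in> sets borel"
proof -
  have "Measurable.pred borel (countably_tested F S)"
    unfolding countably_tested_def
    by (intro pred_Ball_countable pred_Bex_countable pred_intros_countable countable_rat assms(2)) measurable
  then show ?thesis by (simp add: pred_def)
qed

text \<open>The two kinds of bad points are collected over countably many parameters. A point with brackets
  \<open>p\<close> and \<open>q\<close> that lies in none of the sets \<open>A\<close> has the third bracket as well; a common index \<open>n\<close> is
  the maximum of the three.\<close>

lemma exceptional_not_countably_tested:
  fixes F :: "'a::real_normed_vector \<Rightarrow> real"
  assumes F: "cone_increasing K F" and F_borel: "F \<in> borel_measurable borel" and "cone K"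
    and S: "countable S" "S \<noteq> {}" "S \<subseteq> interior K" "0 \<notin> S"
  shows "exceptional {x. \<not> countably_tested F S x}"
proof -
  define \<delta> where "\<delta> k = 1 / (real k + 1)" for k :: nat
  have \<delta>: "0 < \<delta> k" for k by (simp add: \<delta>_def add_nonneg_pos)
  define N where "N w k = {x. \<not> (\<exists>p\<in>\<rat>. \<exists>n. bracketed F x w p (p + \<delta> k) n)}" for w k
  define A where "A w v k p q n = {x. bracketed F x w p (p + \<delta> k) n \<and> bracketed F x v q (q + \<delta> k) n \<and>
      \<not> (\<exists>m. bracketed F x (w - v) (p - q - 2 * \<delta> k) (p - q + 2 * \<delta> k) m)}" for w v k p q n
  have N: "exceptional (N w k)" if "w \<in> S" for w k
    unfolding N_def using that S \<delta> by (intro exceptional_unbracketed[OF F F_borel assms(3)]) auto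
  have A: "exceptional (A w v k p q n)" if "w \<in> S" "v \<in> S" for w v k p q n
  proof -
    have wv: "w \<in> interior K" "v \<in> interior K" "v \<noteq> 0" using that S by auto
    obtain \<epsilon> where "0 < \<epsilon>" "A w v k p q n \<in> A_tilde_eps v \<epsilon>"
      using nonadditive_in_A_tilde_eps[OF F F_borel assms(3) wv(1,2) \<delta>] unfolding A_def by blast
    then show ?thesis by (rule exceptionalI[OF wv(3)])
  qed
  have "exceptional (\<Union>w\<in>S. \<Union>v\<in>S. \<Union>k. N w k \<union> N v k \<union> (\<Union>p\<in>\<rat>. \<Union>q\<in>\<rat>. \<Union>n. A w v k p q n))"
    by (intro exceptional_UN[OF S(1,2)] exceptional_UN_nat exceptional_Un N
        exceptional_UN[OF countable_rat] A) (auto intro: Rats_0)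
  then show ?thesis
  proof (rule exceptional_subset, intro subsetI)
    fix x assume "x \<in> {x. \<not> countably_tested F S x}"
    then obtain w v k where wv: "w \<in> S" "v \<in> S"
      and no: "\<And>p q n. p \<in> \<rat> \<Longrightarrow> q \<in> \<rat> \<Longrightarrow> \<not> (bracketed F x w p (p + \<delta> k) n \<and> bracketed F x v q (q + \<delta> k) n \<and>
         bracketed F x (w - v) (p - q - 2 * \<delta> k) (p - q + 2 * \<delta> k) n)"
      unfolding countably_tested_def \<delta>_def by blast
    have "x \<in> N w k \<union> N v k \<union> (\<Union>p\<in>\<rat>. \<Union>q\<in>\<rat>. \<Union>n. A w v k p q n)"
    proof (rule ccontr)
      assume out: "x \<notin> N w k \<union> N v k \<union> (\<Union>p\<in>\<rat>. \<Union>q\<in>\<rat>. \<Union>n. A w v k p q n)"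
      then obtain p n1 where p: "p \<in> \<rat>" "bracketed F x w p (p + \<delta> k) n1" unfolding N_def by blast
      obtain q n2 where q: "q \<in> \<rat>" "bracketed F x v q (q + \<delta> k) n2" using out unfolding N_def by blast
      have "x \<notin> A w v k p q (max n1 n2)" using out p(1) q(1) by blast
      moreover have "bracketed F x w p (p + \<delta> k) (max n1 n2)" "bracketed F x v q (q + \<delta> k) (max n1 n2)"
        using p q by (auto elim!: bracketed_antimono)
      ultimately obtain m where m: "bracketed F x (w - v) (p - q - 2 * \<delta> k) (p - q + 2 * \<delta> k) m"
        unfolding A_def by blast
      let ?n = "max (max n1 n2) m"
      have "bracketed F x w p (p + \<delta> k) ?n \<and> bracketed F x v q (q + \<delta> k) ?n \<and>
         bracketed F x (w - v) (p - q - 2 * \<delta> k) (p - q + 2 * \<delta> k) ?n"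
        using p(2) q(2) m by (auto elim!: bracketed_antimono)
      then show False using no p(1) q(1) by blast
    qed
    then show "x \<in> (\<Union>w\<in>S. \<Union>v\<in>S. \<Union>k. N w k \<union> N v k \<union> (\<Union>p\<in>\<rat>. \<Union>q\<in>\<rat>. \<Union>n. A w v k p q n))"
      by (rule UN_I[OF wv(1) UN_I[OF wv(2) UN_I[OF UNIV_I]]])
  qed
qed

text \<open>The zero vector has to be avoided since it is not an admissible direction in \<open>C_tilde\<close>. It can be
  interior to \<open>K\<close>, but is never isolated in a nontrivial space.\<close>

lemma countable_dense_directions:
  fixes K :: "'a::real_normed_vector set"
  assumes nontrivial: "\<exists>v::'a. v \<noteq> 0"
    and separable: "separable_space (euclidean :: 'a topology)"
  obtains S where "countable S" "S \<subseteq> interior K" "0 \<notin> S"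
    "\<And>U. open U \<Longrightarrow> U \<inter> interior K \<noteq> {} \<Longrightarrow> U \<inter> S \<noteq> {}"
proof -
  obtain D :: "'a set" where D: "countable D" "closure D = UNIV"
    using separable unfolding separable_space_def by auto
  obtain v0 :: 'a where "v0 \<noteq> 0" using nontrivial by blast
  show thesis
  proof (rule that[of "D \<inter> interior K - {0}"])
    show "countable (D \<inter> interior K - {0})" using D(1) by auto
    show "D \<inter> interior K - {0} \<subseteq> interior K" by blast
    show "0 \<notin> D \<inter> interior K - {0}" by blast
    fix U :: "'a set" assume U: "open U" "U \<inter> interior K \<noteq> {}"
    let ?V = "U \<inter> interior K"
    have "\<exists>y\<in>?V. y \<noteq> 0"
    proof (cases "0 \<in> ?V")
      case True
      have "open ?V" using U(1) by auto
      then obtain e where e: "0 < e" "ball 0 e \<subseteq> ?V" using True openE by blast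
      have "(e / (2 * norm v0)) *\<^sub>R v0 \<in> ball 0 e" using e(1) \<open>v0 \<noteq> 0\<close> by simp
      then show ?thesis using e \<open>v0 \<noteq> 0\<close> by (intro bexI[of _ "(e / (2 * norm v0)) *\<^sub>R v0"]) auto
    next
      case False
      obtain y where "y \<in> ?V" using U(2) by blast
      with False have "y \<noteq> 0" by metis
      with \<open>y \<in> ?V\<close> show ?thesis by (rule bexI[rotated])
    qed
    then have "?V - {0} \<noteq> {}" by blast
    moreover have "open (?V - {0})" using U(1) by (intro open_Diff open_Int) auto
    ultimately have "(?V - {0}) \<inter> D \<noteq> {}"
      using D(2) open_Int_closure_eq_empty by (metis Int_UNIV_right)
    then show "U \<inter> (D \<inter> interior K - {0}) \<noteq> {}" by blast
  qed
qed

lemma gateaux_differentiable_at_uminus: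
  assumes "gateaux_differentiable_at f x"
  shows "gateaux_differentiable_at (\<lambda>y. - f y) x"
proof -
  obtain L where L: "bounded_linear L" "\<And>v. (diff_quot f x v \<longlongrightarrow> L v) (at 0)"
    using assms unfolding gateaux_differentiable_at_iff by blast
  have "diff_quot (\<lambda>y. - f y) x v = (\<lambda>s. - diff_quot f x v s)" for v
    by (auto simp: fun_eq_iff diff_quot_def minus_divide_left)
  then have "(diff_quot (\<lambda>y. - f y) x v \<longlongrightarrow> - L v) (at 0)" for v
    using tendsto_minus[OF L(2)] by simp
  moreover have "bounded_linear (\<lambda>v. - L v)" by (rule bounded_linear_minus[OF L(1)])
  ultimately show ?thesis unfolding gateaux_differentiable_at_iff by (intro exI[of _ "\<lambda>v. - L v"]) blast
qed

theorem increasing_gateaux_except_C_tilde: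
  fixes K :: "'a::real_normed_vector set" and f :: "'a \<Rightarrow> real"
  assumes nontrivial: "\<exists>v::'a. v \<noteq> 0"
    and separable: "separable_space (euclidean :: 'a topology)"
    and "convex K" and "cone K" and "interior K \<noteq> {}" and f: "cone_increasing K f"
  shows "{x. \<not> gateaux_differentiable_at f x} \<in> C_tilde"
proof -
  obtain v where v: "v \<in> interior K" using assms(5) by blast
  define g where "g = lower_envelope v f"
  note g = cone_increasing_lower_envelope[OF assms(4) f v, folded g_def]
    borel_lower_envelope[OF assms(4) f v, folded g_def]
  obtain S where S: "countable S" "S \<subseteq> interior K" "0 \<notin> S"
    "\<And>U. open U \<Longrightarrow> U \<inter> interior K \<noteq> {} \<Longrightarrow> U \<inter> S \<noteq> {}"
    using countable_dense_directions[OF nontrivial separable, of K] by blast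
  have "S \<noteq> {}" using S(4)[of UNIV] assms(5) by simp
  interpret dense_directions K g S by unfold_locales (use assms S g in auto)
  have iff: "gateaux_differentiable_at f x \<longleftrightarrow> countably_tested g S x" for x
    using gateaux_lower_envelope_iff[OF assms(4) f v] gateaux_if_countably_tested countably_tested_if_gateaux
    unfolding g_def by blast
  have "{x. \<not> countably_tested g S x} = space borel - {x. countably_tested g S x}" by auto
  also have "\<dots> \<in> sets borel" by (intro sets.compl_sets borel_countably_tested g S)
  finally have "{x. \<not> countably_tested g S x} \<in> C_tilde"
    using exceptional_not_countably_tested[OF g assms(4) S(1) \<open>S \<noteq> {}\<close> S(2,3)]
    by (intro exceptional_borel_in_C_tilde)
  then show ?thesis by (simp add: iff)
qed

theorem theorem15:
  fixes K :: "'a::banach set" and f :: "'a \<Rightarrow> real"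
  assumes nontrivial: "\<exists>v::'a. v \<noteq> 0"
    and separable: "separable_space (euclidean :: 'a topology)"
    and "closed K" and "convex K" and "cone K" and "interior K \<noteq> {}"
    and "cone_monotone K f"
  shows "{x. \<not> gateaux_differentiable_at f x} \<in> C_tilde"
proof (cases "cone_increasing K f")
  case True
  then show ?thesis by (rule increasing_gateaux_except_C_tilde[OF assms(1,2,4-6)])
next
  case False
  then have "cone_increasing K (\<lambda>x. - f x)" using assms(7) by (simp add: cone_monotone_def)
  then have "{x. \<not> gateaux_differentiable_at (\<lambda>x. - f x) x} \<in> C_tilde"
    by (rule increasing_gateaux_except_C_tilde[OF assms(1,2,4-6)])
  moreover have "gateaux_differentiable_at (\<lambda>x. - f x) x \<longleftrightarrow> gateaux_differentiable_at f x" for x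
    using gateaux_differentiable_at_uminus[of f x] gateaux_differentiable_at_uminus[of "\<lambda>x. - f x" x] by auto
  ultimately show ?thesis by simp
qed

end
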